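(* Consider a two-player zero-sum discounted Markov game $\{\mathcal{S},\mathcal{A},\mathcal{B},P,r,\gamma\}$ with $|\mathcal{A}|\ge|\mathcal{B}|$ and regularization parameter $0<\tau\le1$, and let $\epsilon>0$. Run the policy extragradient value-iteration algorithm (defined in the context, with either PU or OMWU as the inner solver) with constant learning rate $$\eta_t=\eta=\frac{1-\gamma}{2\left(1+\tau(\log|\mathcal{A}|+1-\gamma)\right)}.$$ Then the total number of iterations (namely, the product $T_{\mathrm{main}}\cdot T_{\mathrm{sub}}$) required for the algorithm to achieve $\|Q^{(T_{\mathrm{main}})}-Q_\tau^\star\|_\infty\le\epsilon$ is at most $$O\left(\frac{\log|\mathcal{A}|+1/\tau}{(1-\gamma)^2}\left(\log\frac{\log|\mathcal{A}|}{(1-\gamma)\epsilon}\right)^2\right).$$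
   Context: Markov game: finite state space $\mathcal{S}$, finite action sets $\mathcal{A},\mathcal{B}$, transition kernel $P(\cdot|s,a,b)\in\Delta(\mathcal{S})$, reward $r:\mathcal{S}\times\mathcal{A}\times\mathcal{B}\to[0,1]$, discount $\gamma\in[0,1)$; $\Delta(\cdot)$ denotes the probability simplex. Policies are maps $\mu:\mathcal{S}\to\Delta(\mathcal{A})$, $\nu:\mathcal{S}\to\Delta(\mathcal{B})$. The soft value function is $$V_\tau^{\mu,\nu}(s)=\mathbb{E}\Big[\sum_{t=0}^\infty\gamma^t\big(r(s_t,a_t,b_t)-\tau\log\mu(a_t|s_t)+\tau\log\nu(b_t|s_t)\big)\,\Big|\,s_0=s\Big],$$ the expectation being over trajectories generated by $P$ and $(\mu,\nu)$. The optimal minimax soft value is $V_\tau^\star(s)=\max_\mu\min_\nu V_\tau^{\mu,\nu}(s)=\min_\nu\max_\mu V_\tau^{\mu,\nu}(s)$ and the optimal minimax soft Q-function is $Q_\tau^\star(s,a,b)=r(s,a,b)+\gamma\mathbb{E}_{s'\sim P(\cdot|s,a,b)}[V_\tau^\star(s')]$. $\|\cdot\|_\infty$ is the entrywise maximum norm. For a Q-function $Q$ write $Q(s)\in\mathbb{R}^{|\mathcal{A}|\times|\mathcal{B}|}$ for the matrix with entries $Q(s,a,b)$, and for $\mu(s)\in\Delta(\mathcal{A}),\nu(s)\in\Delta(\mathcal{B})$ set $$f_\tau(Q(s);\mu(s),\nu(s))=\mu(s)^\top Q(s)\nu(s)+\tau\mathcal{H}(\mu(s))-\tau\mathcal{H}(\nu(s)),\qquad\mathcal{H}(\pi)=-\sum_i\pi_i\log\pi_i.$$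 Algorithm: initialize $Q^{(0)}=0$. For $t=0,1,2,\dots,T_{\mathrm{main}}$: for every state $s$, run PU or OMWU for $T_{\mathrm{sub}}$ iterations, from uniform policies and with payoff matrix $A=Q^{(t)}(s)$, on the matrix game $\max_{\mu(s)}\min_{\nu(s)}f_\tau(Q^{(t)}(s);\mu(s),\nu(s))$, and let $\bar\mu^{(t,T_{\mathrm{sub}})}(s),\bar\nu^{(t,T_{\mathrm{sub}})}(s)$ be the last iterate $(\bar\mu^{(T_{\mathrm{sub}})},\bar\nu^{(T_{\mathrm{sub}})})$; set $V^{(t+1)}(s)=f_\tau(Q^{(t)}(s);\bar\mu^{(t,T_{\mathrm{sub}})}(s),\bar\nu^{(t,T_{\mathrm{sub}})}(s))$ and $Q^{(t+1)}(s,a,b)=r(s,a,b)+\gamma\mathbb{E}_{s'\sim P(\cdot|s,a,b)}[V^{(t+1)}(s')]$. PU with payoff matrix $A$: given $(\mu^{(0)},\nu^{(0)})$, for $k=0,1,\dots$ (each line normalized to a probability vector) $$\bar\mu^{(k+1)}(a)\propto\mu^{(k)}(a)^{1-\eta\tau}\exp(\eta[A\nu^{(k)}]_a),\qquad\bar\nu^{(k+1)}(b)\propto\nu^{(k)}(b)^{1-\eta\tau}\exp(-\eta[A^\top\mu^{(k)}]_b),$$ $$\mu^{(k+1)}(a)\propto\mu^{(k)}(a)^{1-\eta\tau}\exp(\eta[A\bar\nu^{(k+1)}]_a),\qquad\nu^{(k+1)}(b)\propto\nu^{(k)}(b)^{1-\eta\tau}\exp(-\eta[A^\top\bar\mu^{(k+1)}]_b).$$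 OMWU: initialized with $\bar\mu^{(0)}=\mu^{(0)}$, $\bar\nu^{(0)}=\nu^{(0)}$, and the first line replaced by $$\bar\mu^{(k+1)}(a)\propto\mu^{(k)}(a)^{1-\eta\tau}\exp(\eta[A\bar\nu^{(k)}]_a),\qquad\bar\nu^{(k+1)}(b)\propto\nu^{(k)}(b)^{1-\eta\tau}\exp(-\eta[A^\top\bar\mu^{(k)}]_b).$$
   Formalization: |A| ≥ 2 is assumed, since log(log|A|) is undefined for |A| = 1; for ε above an absolute threshold ε₀ the bound is taken at ε₀, since as written it vanishes at ε = log|A|/(1−γ), where zero iterations need not suffice. *)

theory Defs
  imports "HOL-Probability.Probability"
begin

text \<open>Carriers are explicit finite sets (rather than finite types), so that the numbers of states
  and actions can be quantified inside a formula, in particular below the constants hidden in an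
  $O$-bound.\<close>

definition markov_game ::
  "'s set \<Rightarrow> 'a set \<Rightarrow> 'b set \<Rightarrow> ('s \<Rightarrow> 'a \<Rightarrow> 'b \<Rightarrow> 's pmf) \<Rightarrow> ('s \<Rightarrow> 'a \<Rightarrow> 'b \<Rightarrow> real) \<Rightarrow> real \<Rightarrow> bool"
where
  "markov_game S A B P r \<gamma> \<longleftrightarrow>
     finite S \<and> S \<noteq> {} \<and> finite A \<and> A \<noteq> {} \<and> finite B \<and> B \<noteq> {} \<and>
     (\<forall>s\<in>S. \<forall>a\<in>A. \<forall>b\<in>B. set_pmf (P s a b) \<subseteq> S \<and> 0 \<le> r s a b \<and> r s a b \<le> 1) \<and>
     0 \<le> \<gamma> \<and> \<gamma> < 1"

definition policies :: "'s set \<Rightarrow> 'a set \<Rightarrow> ('s \<Rightarrow> 'a pmf) set" where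
  "policies S A = {\<mu>. \<forall>s\<in>S. set_pmf (\<mu> s) \<subseteq> A}"


subsection \<open>Trajectories and soft values\<close>

text \<open>A trajectory is a sequence $n \mapsto (s_n, a_n, b_n)$; given $s_n$, the actions $a_n$ and $b_n$
  are drawn independently.\<close>

definition play :: "('s \<Rightarrow> 'a pmf) \<Rightarrow> ('s \<Rightarrow> 'b pmf) \<Rightarrow> 's \<Rightarrow> ('s \<times> 'a \<times> 'b) pmf" where
  "play \<mu> \<nu> s = map_pmf (\<lambda>(a, b). (s, a, b)) (pair_pmf (\<mu> s) (\<nu> s))"

definition trajectory_kernel ::
  "('s \<Rightarrow> 'a \<Rightarrow> 'b \<Rightarrow> 's pmf) \<Rightarrow> ('s \<Rightarrow> 'a pmf) \<Rightarrow> ('s \<Rightarrow> 'b pmf) \<Rightarrow> 's \<Rightarrow>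
     nat \<Rightarrow> (nat \<Rightarrow> 's \<times> 'a \<times> 'b) \<Rightarrow> ('s \<times> 'a \<times> 'b) measure"
where
  "trajectory_kernel P \<mu> \<nu> s n \<omega> = measure_pmf
     (case n of 0 \<Rightarrow> play \<mu> \<nu> s
      | Suc m \<Rightarrow> (case \<omega> m of (s', a, b) \<Rightarrow> bind_pmf (P s' a b) (play \<mu> \<nu>)))"

lemma Ionescu_Tulcea_trajectory_kernel:
  "Ionescu_Tulcea (trajectory_kernel P \<mu> \<nu> s) (\<lambda>_. count_space UNIV)"
proof (rule Ionescu_Tulcea.intro)
  fix n :: nat
  show "trajectory_kernel P \<mu> \<nu> s n \<in>
    PiM {0..<n} (\<lambda>_. count_space UNIV) \<rightarrow>\<^sub>M subprob_algebra (count_space UNIV)"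
  proof (cases n)
    case 0
    then show ?thesis
      by (simp add: trajectory_kernel_def[abs_def] space_subprob_algebra
            measure_pmf.subprob_space_axioms)
  next
    case (Suc m)
    have "(\<lambda>x. measure_pmf (case x of (s', a, b) \<Rightarrow> bind_pmf (P s' a b) (play \<mu> \<nu>)))
        \<in> count_space UNIV \<rightarrow>\<^sub>M subprob_algebra (count_space UNIV)"
      by (auto simp: space_subprob_algebra measure_pmf.subprob_space_axioms)
    moreover have "(\<lambda>\<omega>. \<omega> m) \<in>
        PiM {0..<n} (\<lambda>_. count_space (UNIV :: ('a \<times> 'b \<times> 'c) set)) \<rightarrow>\<^sub>M count_space UNIV"
      using Suc by (intro measurable_component_singleton) auto
    ultimately show ?thesis
      unfolding trajectory_kernel_def[abs_def] Suc
      by (simp add: measurable_compose)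
  qed
qed (simp add: trajectory_kernel_def measure_pmf.prob_space_axioms)

text \<open>The law of the infinite trajectory started in a given state, built by the Ionescu-Tulcea theorem.\<close>

definition trajectory_law ::
  "('s \<Rightarrow> 'a \<Rightarrow> 'b \<Rightarrow> 's pmf) \<Rightarrow> ('s \<Rightarrow> 'a pmf) \<Rightarrow> ('s \<Rightarrow> 'b pmf) \<Rightarrow> 's \<Rightarrow>
     (nat \<Rightarrow> 's \<times> 'a \<times> 'b) measure"
where
  "trajectory_law P \<mu> \<nu> s =
     projective_family.lim UNIV
       (Ionescu_Tulcea.CI (trajectory_kernel P \<mu> \<nu> s) (\<lambda>_. count_space UNIV))
       (\<lambda>_. count_space UNIV)"

definition soft_value ::
  "('s \<Rightarrow> 'a \<Rightarrow> 'b \<Rightarrow> 's pmf) \<Rightarrow> ('s \<Rightarrow> 'a \<Rightarrow> 'b \<Rightarrow> real) \<Rightarrow> real \<Rightarrow> real \<Rightarrow>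
     ('s \<Rightarrow> 'a pmf) \<Rightarrow> ('s \<Rightarrow> 'b pmf) \<Rightarrow> 's \<Rightarrow> real"
where
  "soft_value P r \<gamma> \<tau> \<mu> \<nu> s =
     (\<integral>\<omega>. (\<Sum>t. \<gamma> ^ t * (case \<omega> t of (s', a, b) \<Rightarrow>
               r s' a b - \<tau> * ln (pmf (\<mu> s') a) + \<tau> * ln (pmf (\<nu> s') b)))
       \<partial>trajectory_law P \<mu> \<nu> s)"

text \<open>The optimal value is the max-min value; it coincides with the min-max value, and both
  extrema are attained, so writing suprema and infima here loses nothing.\<close>

definition optimal_soft_value ::
  "'s set \<Rightarrow> 'a set \<Rightarrow> 'b set \<Rightarrow> ('s \<Rightarrow> 'a \<Rightarrow> 'b \<Rightarrow> 's pmf) \<Rightarrow> ('s \<Rightarrow> 'a \<Rightarrow> 'b \<Rightarrow> real) \<Rightarrow>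
     real \<Rightarrow> real \<Rightarrow> 's \<Rightarrow> real"
where
  "optimal_soft_value S A B P r \<gamma> \<tau> s =
     (SUP \<mu>\<in>policies S A. INF \<nu>\<in>policies S B. soft_value P r \<gamma> \<tau> \<mu> \<nu> s)"

definition backup ::
  "('s \<Rightarrow> 'a \<Rightarrow> 'b \<Rightarrow> 's pmf) \<Rightarrow> ('s \<Rightarrow> 'a \<Rightarrow> 'b \<Rightarrow> real) \<Rightarrow> real \<Rightarrow> ('s \<Rightarrow> real) \<Rightarrow>
     's \<Rightarrow> 'a \<Rightarrow> 'b \<Rightarrow> real"
where
  "backup P r \<gamma> V s a b = r s a b + \<gamma> * measure_pmf.expectation (P s a b) V"

definition optimal_soft_Q ::
  "'s set \<Rightarrow> 'a set \<Rightarrow> 'b set \<Rightarrow> ('s \<Rightarrow> 'a \<Rightarrow> 'b \<Rightarrow> 's pmf) \<Rightarrow> ('s \<Rightarrow> 'a \<Rightarrow> 'b \<Rightarrow> real) \<Rightarrow>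
     real \<Rightarrow> real \<Rightarrow> 's \<Rightarrow> 'a \<Rightarrow> 'b \<Rightarrow> real"
where
  "optimal_soft_Q S A B P r \<gamma> \<tau> = backup P r \<gamma> (optimal_soft_value S A B P r \<gamma> \<tau>)"

definition max_norm :: "'s set \<Rightarrow> 'a set \<Rightarrow> 'b set \<Rightarrow> ('s \<Rightarrow> 'a \<Rightarrow> 'b \<Rightarrow> real) \<Rightarrow> real" where
  "max_norm S A B Q = Max ((\<lambda>(s, a, b). \<bar>Q s a b\<bar>) ` (S \<times> A \<times> B))"


subsection \<open>Entropy-regularized matrix games\<close>

text \<open>Here mixed strategies are real vectors indexed by a finite set; only their entries on that
  set matter. Note that \<^term>\<open>0 * ln (0::real) = 0\<close>.\<close>

definition entropy :: "'i set \<Rightarrow> ('i \<Rightarrow> real) \<Rightarrow> real" where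
  "entropy I p = - (\<Sum>i\<in>I. p i * ln (p i))"

definition f_reg ::
  "'a set \<Rightarrow> 'b set \<Rightarrow> real \<Rightarrow> ('a \<Rightarrow> 'b \<Rightarrow> real) \<Rightarrow> ('a \<Rightarrow> real) \<Rightarrow> ('b \<Rightarrow> real) \<Rightarrow> real"
where
  "f_reg A B \<tau> M p q =
     (\<Sum>a\<in>A. \<Sum>b\<in>B. p a * M a b * q b) + \<tau> * entropy A p - \<tau> * entropy B q"

definition uniform :: "'i set \<Rightarrow> 'i \<Rightarrow> real" where
  "uniform I = (\<lambda>_. 1 / real (card I))"

definition normalized :: "'i set \<Rightarrow> ('i \<Rightarrow> real) \<Rightarrow> 'i \<Rightarrow> real" where
  "normalized I w = (\<lambda>i. w i / (\<Sum>j\<in>I. w j))"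

text \<open>One multiplicative-weights line: the new strategy of the max player (resp. min player) from
  its base point and a strategy of the opponent.\<close>

definition max_update ::
  "'a set \<Rightarrow> 'b set \<Rightarrow> real \<Rightarrow> real \<Rightarrow> ('a \<Rightarrow> 'b \<Rightarrow> real) \<Rightarrow> ('a \<Rightarrow> real) \<Rightarrow> ('b \<Rightarrow> real) \<Rightarrow> 'a \<Rightarrow> real"
where
  "max_update A B \<eta> \<tau> M p q =
     normalized A (\<lambda>a. p a powr (1 - \<eta> * \<tau>) * exp (\<eta> * (\<Sum>b\<in>B. M a b * q b)))"

definition min_update ::
  "'a set \<Rightarrow> 'b set \<Rightarrow> real \<Rightarrow> real \<Rightarrow> ('a \<Rightarrow> 'b \<Rightarrow> real) \<Rightarrow> ('b \<Rightarrow> real) \<Rightarrow> ('a \<Rightarrow> real) \<Rightarrow> 'b \<Rightarrow> real"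
where
  "min_update A B \<eta> \<tau> M q p =
     normalized B (\<lambda>b. q b powr (1 - \<eta> * \<tau>) * exp (- \<eta> * (\<Sum>a\<in>A. M a b * p a)))"

datatype inner_solver = PU | OMWU

text \<open>The state of the solvers is $(\mu, \nu, \bar\mu, \bar\nu)$. They differ only in the opponent
  strategy that enters the prediction of $(\bar\mu, \bar\nu)$.\<close>

type_synonym ('a, 'b) iterate = "('a \<Rightarrow> real) \<times> ('b \<Rightarrow> real) \<times> ('a \<Rightarrow> real) \<times> ('b \<Rightarrow> real)"

fun solver_step ::
  "inner_solver \<Rightarrow> 'a set \<Rightarrow> 'b set \<Rightarrow> real \<Rightarrow> real \<Rightarrow> ('a \<Rightarrow> 'b \<Rightarrow> real) \<Rightarrow>
     ('a, 'b) iterate \<Rightarrow> ('a, 'b) iterate"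
where
  "solver_step alg A B \<eta> \<tau> M (\<mu>, \<nu>, \<mu>b, \<nu>b) =
     (let p = (case alg of PU \<Rightarrow> \<mu> | OMWU \<Rightarrow> \<mu>b);
          q = (case alg of PU \<Rightarrow> \<nu> | OMWU \<Rightarrow> \<nu>b);
          \<mu>b' = max_update A B \<eta> \<tau> M \<mu> q;
          \<nu>b' = min_update A B \<eta> \<tau> M \<nu> p
      in (max_update A B \<eta> \<tau> M \<mu> \<nu>b', min_update A B \<eta> \<tau> M \<nu> \<mu>b', \<mu>b', \<nu>b'))"

definition solver_iterate ::
  "inner_solver \<Rightarrow> 'a set \<Rightarrow> 'b set \<Rightarrow> real \<Rightarrow> real \<Rightarrow> ('a \<Rightarrow> 'b \<Rightarrow> real) \<Rightarrow> nat \<Rightarrow> ('a, 'b) iterate"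
where
  "solver_iterate alg A B \<eta> \<tau> M k =
     (solver_step alg A B \<eta> \<tau> M ^^ k) (uniform A, uniform B, uniform A, uniform B)"


subsection \<open>Policy extragradient value iteration\<close>

definition approx_value ::
  "inner_solver \<Rightarrow> 'a set \<Rightarrow> 'b set \<Rightarrow> real \<Rightarrow> real \<Rightarrow> nat \<Rightarrow> ('s \<Rightarrow> 'a \<Rightarrow> 'b \<Rightarrow> real) \<Rightarrow> 's \<Rightarrow> real"
where
  "approx_value alg A B \<eta> \<tau> Tsub Q s =
     (case solver_iterate alg A B \<eta> \<tau> (Q s) Tsub of (_, _, \<mu>b, \<nu>b) \<Rightarrow> f_reg A B \<tau> (Q s) \<mu>b \<nu>b)"

primrec Q_iterate ::
  "inner_solver \<Rightarrow> 'a set \<Rightarrow> 'b set \<Rightarrow> ('s \<Rightarrow> 'a \<Rightarrow> 'b \<Rightarrow> 's pmf) \<Rightarrow> ('s \<Rightarrow> 'a \<Rightarrow> 'b \<Rightarrow> real) \<Rightarrow>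
     real \<Rightarrow> real \<Rightarrow> real \<Rightarrow> nat \<Rightarrow> nat \<Rightarrow> 's \<Rightarrow> 'a \<Rightarrow> 'b \<Rightarrow> real"
where
  "Q_iterate alg A B P r \<gamma> \<eta> \<tau> Tsub 0 = (\<lambda>_ _ _. 0)"
| "Q_iterate alg A B P r \<gamma> \<eta> \<tau> Tsub (Suc t) =
     backup P r \<gamma> (approx_value alg A B \<eta> \<tau> Tsub (Q_iterate alg A B P r \<gamma> \<eta> \<tau> Tsub t))"

end

theory Submission
  imports Defs
begin

text \<open>For a matrix game with entropy regularization, the equilibrium is a pair of mutual Gibbs best
  responses. Each solver step contracts, by the factor $1 - \eta\tau$, the potential
  $\mathrm{KL}(\zeta^\star \| \zeta^{(k)}) + (1 - \eta W)\, \mathrm{KL}(\zeta^{(k)} \| \bar\zeta^{(k)})$,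
  where $\zeta = (\mu, \nu)$ and $W$ is the oscillation of the payoffs, and the error in the game value
  is at most $3/\eta$ times the potential, without any factor $1/\tau$. The step size is small enough
  for this since the oscillation of all $Q^{(t)}$ is at most $\frac{9}{8} (1 - \gamma)^{-1}$. The minimax
  soft Bellman operator is a $\gamma$-contraction whose fixed point is the optimal value, so inner
  errors of size $(1 - \gamma) \epsilon / 2$ accumulate to at most $\epsilon / 2$.\<close>

subsection \<open>Kullback-Leibler divergence\<close>

text \<open>The logarithm in the bound contains no \<tau>, so a value error of order potential /
  \<tau> would cost an extra log(1 / \<tau>) in the inner iteration count. In the expansion of the
  payoff around the equilibrium, the divergences from the equilibrium carry the weight \<tau>, which
  cancels this loss. Only the bilinear cross term lacks the weight; it is estimated through
  divergences to the current iterate, which the potential dominates at a cost independent of \<tau>.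
  Adding one constant to all payoffs changes none of the normalized updates, so the natural size of
  a payoff matrix is its oscillation. The maximum norm of the iterates may contain a term of order
  \<tau> log|A| / (1 - \<gamma>); their oscillation does not, and the constant 9/8 leaves room for
  the inner errors. Soft values are integrals over infinite trajectories. They are tied to the
  algorithm by their Bellman equation alone: a comparison of sub- and supersolutions then identifies
  the max-min value with the fixed point of the minimax operator.\<close>

definition prob_vec :: "'i set \<Rightarrow> ('i \<Rightarrow> real) \<Rightarrow> bool" where
  "prob_vec I p \<longleftrightarrow> (\<forall>i\<in>I. 0 \<le> p i) \<and> sum p I = 1"

definition kl :: "'i set \<Rightarrow> ('i \<Rightarrow> real) \<Rightarrow> ('i \<Rightarrow> real) \<Rightarrow> real" where
  "kl I p q = (\<Sum>i\<in>I. p i * (ln (p i) - ln (q i)))"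

definition l1_dist :: "'i set \<Rightarrow> ('i \<Rightarrow> real) \<Rightarrow> ('i \<Rightarrow> real) \<Rightarrow> real" where
  "l1_dist I p q = (\<Sum>i\<in>I. \<bar>p i - q i\<bar>)"

lemma ln_term_ge:
  fixes p q :: real
  assumes "0 \<le> p" "0 \<le> q" "q = 0 \<Longrightarrow> p = 0"
  shows "p - q \<le> p * (ln p - ln q)"
proof (cases "p = 0")
  case False
  then have p: "0 < p" using assms by auto
  with assms have q: "0 < q" by (cases "q = 0") auto
  have "ln (q / p) \<le> q / p - 1" using p q by (intro ln_le_minus_one) auto
  then have "p * (ln q - ln p) \<le> p * (q / p - 1)" using p q by (simp add: ln_div)
  also have "\<dots> = q - p" using p by (simp add: field_simps)
  finally show ?thesis by (simp add: algebra_simps)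
qed (use assms in auto)

lemma kl_nonneg:
  assumes "prob_vec I p" "prob_vec I q" "\<And>i. i \<in> I \<Longrightarrow> q i = 0 \<Longrightarrow> p i = 0"
  shows "0 \<le> kl I p q"
proof -
  have "0 = (\<Sum>i\<in>I. p i - q i)" using assms by (simp add: prob_vec_def sum_subtractf)
  also have "\<dots> \<le> kl I p q"
    unfolding kl_def using assms by (intro sum_mono ln_term_ge) (auto simp: prob_vec_def)
  finally show ?thesis .
qed

lemma kl_self [simp]: "kl I p p = 0"
  by (simp add: kl_def)

text \<open>The difference of the two sides has derivative
  \<open>(y - 1) ^ 3 / (y\<^sup>2 * (y + 2)\<^sup>2)\<close>, so its minimum is 0, at 1. Multiplied
  by \<open>x * (2 * x + 4)\<close>, this is the pointwise inequality behind Pinsker's; the division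
  isolates the logarithm and makes the derivative rational. \<open>pinsker_term\<close> is the
  homogeneous version with \<open>x = p / q\<close>.\<close>

lemma ln_quadratic_lower_bound:
  fixes x :: real
  assumes "0 < x"
  shows "(x - 1) / x + 3 * (x - 1)\<^sup>2 / (x * (2 * x + 4)) \<le> ln x"
proof -
  define \<phi> where "\<phi> = (\<lambda>x::real. ln x - (x - 1) / x - 3 * (x - 1)\<^sup>2 / (x * (2 * x + 4)))"
  have D: "(\<phi> has_real_derivative (y - 1) ^ 3 / (y\<^sup>2 * (y + 2)\<^sup>2)) (at y)" if "0 < y" for y
  proof -
    have nz: "y * (2 * y + 4) \<noteq> 0" "y \<noteq> 0" "y + 2 \<noteq> 0" "2 * y + 4 \<noteq> 0" using that by auto
    have "(\<phi> has_real_derivative 1 / y - (1 * y - (y - 1) * 1) / (y * y)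
      - ((3 * (2 * (y - 1))) * (y * (2 * y + 4)) - 3 * (y - 1)\<^sup>2 * (4 * y + 4))
          / ((y * (2 * y + 4)) * (y * (2 * y + 4)))) (at y)"
      unfolding \<phi>_def using that nz
      by (auto intro!: derivative_eq_intros simp: algebra_simps)
    moreover have "1 / y - (1 * y - (y - 1) * 1) / (y * y)
      - ((3 * (2 * (y - 1))) * (y * (2 * y + 4)) - 3 * (y - 1)\<^sup>2 * (4 * y + 4))
          / ((y * (2 * y + 4)) * (y * (2 * y + 4))) = (y - 1) ^ 3 / (y\<^sup>2 * (y + 2)\<^sup>2)"
    proof -
      have e: "y * (2 * y + 4) = 2 * (y * (y + 2))" by (simp add: algebra_simps)
      show ?thesis unfolding e using nz
        by (simp add: divide_simps) (simp add: power2_eq_square power3_eq_cube algebra_simps)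
    qed
    ultimately show ?thesis by simp
  qed
  have "\<phi> 1 \<le> \<phi> x"
  proof (cases "1 \<le> x")
    case True
    then show ?thesis
      by (intro DERIV_nonneg_imp_nondecreasing[of 1 x \<phi>] exI[of _ "(y - 1) ^ 3 / (y\<^sup>2 * (y + 2)\<^sup>2)" for y])
         (auto intro!: D)
  next
    case False
    then show ?thesis using assms
      by (intro DERIV_nonpos_imp_nonincreasing[of x 1 \<phi>] exI[of _ "(y - 1) ^ 3 / (y\<^sup>2 * (y + 2)\<^sup>2)" for y])
         (auto intro!: D divide_nonpos_nonneg simp: power_le_zero_eq)
  qed
  then show ?thesis by (simp add: \<phi>_def)
qed

lemma pinsker_term:
  fixes p q :: real
  assumes "0 \<le> p" "0 < q"
  shows "3 * (p - q)\<^sup>2 \<le> (2 * p + 4 * q) * (p * (ln p - ln q) - p + q)"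
proof (cases "p = 0")
  case True
  then show ?thesis using assms by (simp add: power2_eq_square)
next
  case False
  then have p: "0 < p" using assms by simp
  define x where "x = p / q"
  have x: "0 < x" and px: "p = x * q" using p assms by (auto simp: x_def)
  have ln: "ln p - ln q = ln x" using p assms by (simp add: x_def ln_div)
  have "x * (2 * x + 4) * ((x - 1) / x + 3 * (x - 1)\<^sup>2 / (x * (2 * x + 4))) \<le> x * (2 * x + 4) * ln x"
    using x ln_quadratic_lower_bound[OF x] by (intro mult_left_mono) auto
  also have "x * (2 * x + 4) * ((x - 1) / x + 3 * (x - 1)\<^sup>2 / (x * (2 * x + 4)))
      = (2 * x + 4) * (x - 1) + 3 * (x - 1)\<^sup>2"
  proof -
    have "2 * x + 4 \<noteq> 0" using x by simp
    then show ?thesis using x by (simp add: divide_simps)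
  qed
  finally have "3 * (x - 1)\<^sup>2 \<le> (2 * x + 4) * (x * ln x - x + 1)" by (simp add: algebra_simps)
  then have "q\<^sup>2 * (3 * (x - 1)\<^sup>2) \<le> q\<^sup>2 * ((2 * x + 4) * (x * ln x - x + 1))"
    by (intro mult_left_mono) auto
  then show ?thesis unfolding ln unfolding px by (simp add: power2_eq_square algebra_simps)
qed

text \<open>Cauchy-Schwarz applied to \<open>pinsker_term\<close>: the weights \<open>a\<close> have
  total mass 2, and the extra terms \<open>- p i + q i\<close> in \<open>b\<close> make each summand
  nonnegative but cancel in the sum.\<close>

lemma pinsker:
  assumes "prob_vec I p" "prob_vec I q" "\<And>i. i \<in> I \<Longrightarrow> 0 < q i"
  shows "(l1_dist I p q)\<^sup>2 \<le> 2 * kl I p q"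
proof -
  define a where "a i = (2 * p i + 4 * q i) / 3" for i
  define b where "b i = p i * (ln (p i) - ln (q i)) - p i + q i" for i
  have b: "0 \<le> b i" if "i \<in> I" for i
    using assms that ln_term_ge[of "p i" "q i"] by (force simp: b_def prob_vec_def)
  have a: "0 \<le> a i" if "i \<in> I" for i
    using assms that by (auto simp: a_def prob_vec_def less_imp_le)
  have "\<bar>p i - q i\<bar> \<le> sqrt (a i) * sqrt (b i)" if "i \<in> I" for i
  proof -
    have "(p i - q i)\<^sup>2 \<le> a i * b i"
      using pinsker_term[of "p i" "q i"] assms that by (simp add: prob_vec_def a_def b_def)
    then show ?thesis by (metis real_sqrt_abs real_sqrt_le_iff real_sqrt_mult)
  qed
  then have "l1_dist I p q \<le> (\<Sum>i\<in>I. sqrt (a i) * sqrt (b i))"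
    unfolding l1_dist_def by (intro sum_mono)
  then have "(l1_dist I p q)\<^sup>2 \<le> (\<Sum>i\<in>I. sqrt (a i) * sqrt (b i))\<^sup>2"
    by (intro power_mono) (auto simp: l1_dist_def sum_nonneg)
  also have "\<dots> \<le> (\<Sum>i\<in>I. (sqrt (a i))\<^sup>2) * (\<Sum>i\<in>I. (sqrt (b i))\<^sup>2)"
    by (rule Cauchy_Schwarz_ineq_sum)
  also have "\<dots> = (\<Sum>i\<in>I. a i) * (\<Sum>i\<in>I. b i)"
    using a b by simp
  also have "(\<Sum>i\<in>I. a i) = 2"
    using assms unfolding a_def prob_vec_def
    by (simp add: sum_divide_distrib[symmetric] sum.distrib sum_distrib_left[symmetric])
  also have "(\<Sum>i\<in>I. b i) = kl I p q"
    using assms unfolding b_def prob_vec_def by (simp add: kl_def sum.distrib sum_subtractf)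
  finally show ?thesis .
qed

text \<open>The three-point identity of a regularized mirror step with base \<open>p\<close>, prediction \<open>pb\<close>,
  update \<open>p'\<close> and comparator \<open>ps\<close>.\<close>

lemma kl_mirror_step:
  fixes \<eta> \<tau> :: real
  assumes p': "\<And>i. i \<in> I \<Longrightarrow> ln (p' i) = (1 - \<eta> * \<tau>) * ln (p i) + \<eta> * w i - c'"
    and pb: "\<And>i. i \<in> I \<Longrightarrow> ln (pb i) = (1 - \<eta> * \<tau>) * ln (p i) + \<eta> * u i - cb"
    and ps: "\<And>i. i \<in> I \<Longrightarrow> \<tau> * ln (ps i) = ws i - cs"
    and sums: "sum p' I = 1" "sum pb I = 1" "sum ps I = 1"
  shows "kl I ps p' = (1 - \<eta> * \<tau>) * kl I ps p - (1 - \<eta> * \<tau>) * kl I pb p - \<eta> * \<tau> * kl I pb ps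
           - kl I p' pb + \<eta> * (\<Sum>i\<in>I. (u i - w i) * (pb i - p' i))
           + \<eta> * (\<Sum>i\<in>I. (w i - ws i) * (pb i - ps i))"
proof -
  \<comment> \<open>With all terms on one side, the logarithms cancel index by index. What remains
    is the normalizing constants times \<open>pb - p'\<close> and \<open>pb - ps\<close>, both of
    total mass zero.\<close>
  have pt: "ps i * (ln (ps i) - ln (p' i)) - (1 - \<eta> * \<tau>) * (ps i * (ln (ps i) - ln (p i)))
      + (1 - \<eta> * \<tau>) * (pb i * (ln (pb i) - ln (p i))) + \<eta> * \<tau> * (pb i * (ln (pb i) - ln (ps i)))
      + p' i * (ln (p' i) - ln (pb i)) - \<eta> * ((u i - w i) * (pb i - p' i))
      - \<eta> * ((w i - ws i) * (pb i - ps i))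
      = (c' - cb) * (pb i - p' i) + (\<eta> * cs - c') * (pb i - ps i)" if i: "i \<in> I" for i
  proof -
    have u: "\<eta> * u i = ln (pb i) - (1 - \<eta> * \<tau>) * ln (p i) + cb" using pb[OF i] by simp
    have w: "\<eta> * w i = ln (p' i) - (1 - \<eta> * \<tau>) * ln (p i) + c'" using p'[OF i] by simp
    have s: "\<eta> * ws i = \<eta> * \<tau> * ln (ps i) + \<eta> * cs"
      using arg_cong[OF ps[OF i], of "(*) \<eta>"] by (simp add: algebra_simps)
    have 1: "\<eta> * ((u i - w i) * (pb i - p' i)) = (\<eta> * u i - \<eta> * w i) * (pb i - p' i)"
      "\<eta> * ((w i - ws i) * (pb i - ps i)) = (\<eta> * w i - \<eta> * ws i) * (pb i - ps i)"
      by (simp_all add: algebra_simps)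
    show ?thesis unfolding 1 u w s by (simp add: algebra_simps)
  qed
  have "kl I ps p' - (1 - \<eta> * \<tau>) * kl I ps p + (1 - \<eta> * \<tau>) * kl I pb p + \<eta> * \<tau> * kl I pb ps
      + kl I p' pb - \<eta> * (\<Sum>i\<in>I. (u i - w i) * (pb i - p' i))
      - \<eta> * (\<Sum>i\<in>I. (w i - ws i) * (pb i - ps i))
    = (\<Sum>i\<in>I. (c' - cb) * (pb i - p' i) + (\<eta> * cs - c') * (pb i - ps i))"
    unfolding kl_def sum_distrib_left sum.distrib[symmetric] sum_subtractf[symmetric]
    by (intro sum.cong refl pt)
  also have "\<dots> = 0"
    using sums by (simp add: sum.distrib sum_distrib_left[symmetric] sum_subtractf)
  finally show ?thesis by simp
qed

subsection \<open>Equilibria of regularized matrix games\<close>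

lemma continuous_on_x_ln_x: "continuous_on {0..} (\<lambda>x::real. x * ln x)"
  unfolding continuous_on_def
proof
  fix x :: real assume "x \<in> {0..}"
  show "((\<lambda>x. x * ln x) \<longlongrightarrow> x * ln x) (at x within {0..})"
  proof (cases "x = 0")
    case True
    have "{0..} - {0} = {0<..} - {0::real}" by auto
    then have right: "at (0::real) within {0..} = at_right 0" by (simp add: at_within_def)
    have "((\<lambda>x::real. - (ln (inverse x) / inverse x)) \<longlongrightarrow> - 0) (at_right 0)"
      by (intro tendsto_minus filterlim_compose[OF ln_x_over_x_tendsto_0 filterlim_inverse_at_top_right])
    moreover have "eventually (\<lambda>x::real. - (ln (inverse x) / inverse x) = x * ln x) (at_right 0)"
      by (auto simp: eventually_at_filter ln_inverse divide_inverse)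
    ultimately have "((\<lambda>x::real. x * ln x) \<longlongrightarrow> 0) (at_right 0)"
      by (simp add: tendsto_cong)
    then have "((\<lambda>x::real. x * ln x) \<longlongrightarrow> 0) (at 0 within {0..})"
      unfolding right .
    with True show ?thesis by simp
  next
    case False
    then show ?thesis using \<open>x \<in> {0..}\<close> by (auto intro!: tendsto_intros)
  qed
qed

definition bilin :: "'a set \<Rightarrow> 'b set \<Rightarrow> ('a \<Rightarrow> 'b \<Rightarrow> real) \<Rightarrow> ('a \<Rightarrow> real) \<Rightarrow> ('b \<Rightarrow> real) \<Rightarrow> real" where
  "bilin A B M p q = (\<Sum>a\<in>A. \<Sum>b\<in>B. p a * M a b * q b)"

lemma f_reg_bilin: "f_reg A B \<tau> M p q = bilin A B M p q + \<tau> * entropy A p - \<tau> * entropy B q"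
  by (simp add: f_reg_def bilin_def)

lemma bilin_left: "bilin A B M p q = (\<Sum>a\<in>A. p a * (\<Sum>b\<in>B. M a b * q b))"
  by (simp add: bilin_def sum_distrib_left mult.assoc)

lemma bilin_right: "bilin A B M p q = (\<Sum>b\<in>B. q b * (\<Sum>a\<in>A. M a b * p a))"
  unfolding bilin_def by (subst sum.swap) (simp add: sum_distrib_left mult_ac)

lemma bilin_add_left: "bilin A B M (\<lambda>a. x * p a + y * p' a) q = x * bilin A B M p q + y * bilin A B M p' q"
  by (simp add: bilin_def sum_distrib_left sum.distrib algebra_simps)

lemma bilin_diff:
  "bilin A B M (\<lambda>a. p a - p' a) (\<lambda>b. q b - q' b)
     = bilin A B M p q - bilin A B M p q' - bilin A B M p' q + bilin A B M p' q'"
  by (simp add: bilin_def sum_subtractf sum.distrib algebra_simps)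

text \<open>Gibbs variational principle: \<open>c\<close> is \<tau> times the log-partition
  function, the largest value of linear payoff plus weighted entropy, and the divergence from the
  Gibbs point \<open>m\<close> measures how far \<open>p\<close> falls short of it.\<close>

lemma kl_gibbs:
  assumes "\<And>i. i \<in> I \<Longrightarrow> \<tau> * ln (m i) = v i - c" "sum p I = 1"
  shows "\<tau> * kl I p m = c - \<tau> * entropy I p - (\<Sum>i\<in>I. p i * v i)"
proof -
  have "\<tau> * kl I p m = (\<Sum>i\<in>I. \<tau> * (p i * ln (p i)) - p i * (\<tau> * ln (m i)))"
    by (simp add: kl_def sum_distrib_left algebra_simps)
  also have "\<dots> = (\<Sum>i\<in>I. \<tau> * (p i * ln (p i)) - p i * (v i - c))"
    using assms by simp
  also have "\<dots> = - \<tau> * entropy I p - (\<Sum>i\<in>I. p i * v i) + sum p I * c"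
    by (simp add: entropy_def sum_distrib_left sum_distrib_right sum.distrib sum_subtractf sum_negf algebra_simps)
  finally show ?thesis using assms by simp
qed

lemma entropy_gibbs:
  assumes "\<And>i. i \<in> I \<Longrightarrow> \<tau> * ln (m i) = v i - c" "sum m I = 1"
  shows "\<tau> * entropy I m = c - (\<Sum>i\<in>I. m i * v i)"
  using kl_gibbs[where m = m and p = m, OF assms] by simp

lemma entropy_nonneg: "prob_vec I p \<Longrightarrow> finite I \<Longrightarrow> 0 \<le> entropy I p"
proof -
  assume p: "prob_vec I p" "finite I"
  have "p i * ln (p i) \<le> 0" if "i \<in> I" for i
  proof -
    have "p i \<le> 1" using p that member_le_sum[of i I p] by (auto simp: prob_vec_def)
    then show ?thesis using p that by (cases "p i = 0") (auto simp: prob_vec_def intro!: mult_nonneg_nonpos)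
  qed
  then show ?thesis by (simp add: entropy_def sum_nonpos)
qed

lemma prob_vec_uniform: "finite I \<Longrightarrow> I \<noteq> {} \<Longrightarrow> prob_vec I (uniform I)"
  by (simp add: prob_vec_def uniform_def)

lemma kl_uniform:
  assumes "prob_vec I p" "finite I" "I \<noteq> {}"
  shows "kl I p (uniform I) = ln (card I) - entropy I p"
  using kl_gibbs[of I 1 "uniform I" "\<lambda>_. 0" "ln (card I)" p] assms
  by (simp add: prob_vec_def uniform_def ln_div)

lemma entropy_uniform: "finite I \<Longrightarrow> I \<noteq> {} \<Longrightarrow> entropy I (uniform I) = ln (card I)"
  using kl_uniform[OF prob_vec_uniform, of I] by simp

lemma entropy_le_ln_card:
  assumes "prob_vec I p" "finite I" "I \<noteq> {}"
  shows "entropy I p \<le> ln (card I)"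
  using kl_nonneg[OF assms(1) prob_vec_uniform[OF assms(2,3)]] kl_uniform[OF assms] assms
  by (simp add: uniform_def)

lemma entropy_concave:
  assumes "prob_vec I p" "prob_vec I q" "0 < t" "t < 1"
  shows "(1 - t) * entropy I p + t * entropy I q \<le> entropy I (\<lambda>i. (1 - t) * p i + t * q i)"
proof -
  let ?m = "\<lambda>i. (1 - t) * p i + t * q i"
  have m: "prob_vec I ?m"
    using assms by (auto simp: prob_vec_def sum.distrib sum_distrib_left[symmetric])
  have z: "p i = 0 \<and> q i = 0" if "i \<in> I" "?m i = 0" for i
  proof -
    have "0 \<le> (1 - t) * p i" "0 \<le> t * q i" using assms that by (auto simp: prob_vec_def)
    then have "(1 - t) * p i = 0" "t * q i = 0" using that(2) by linarith+
    then show ?thesis using assms by simp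
  qed
  \<comment> \<open>The gap in concavity is the Jensen-Shannon divergence, a mixture of divergences
    to the midpoint \<open>?m\<close>, hence nonnegative.\<close>
  have "0 \<le> (1 - t) * kl I p ?m + t * kl I q ?m"
    using assms m z by (intro add_nonneg_nonneg mult_nonneg_nonneg kl_nonneg) auto
  also have "\<dots> = entropy I ?m - (1 - t) * entropy I p - t * entropy I q"
    by (simp add: kl_def entropy_def sum_distrib_left sum.distrib[symmetric] sum_subtractf[symmetric]
          sum_negf[symmetric] algebra_simps)
  finally show ?thesis by simp
qed

lemma normalized_pos:
  assumes "finite I" "I \<noteq> {}" "\<And>i. i \<in> I \<Longrightarrow> 0 < w i"
  shows "prob_vec I (normalized I w)" "\<And>i. i \<in> I \<Longrightarrow> 0 < normalized I w i"
    "\<And>i. i \<in> I \<Longrightarrow> ln (normalized I w i) = ln (w i) - ln (sum w I)"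
proof -
  have s: "0 < sum w I" using assms by (intro sum_pos) auto
  then show "prob_vec I (normalized I w)"
    using assms by (auto simp: prob_vec_def normalized_def sum_divide_distrib[symmetric] less_imp_le)
  show "\<And>i. i \<in> I \<Longrightarrow> 0 < normalized I w i" using s assms by (simp add: normalized_def)
  show "\<And>i. i \<in> I \<Longrightarrow> ln (normalized I w i) = ln (w i) - ln (sum w I)"
    using s assms(3) by (force simp: normalized_def ln_div)
qed

text \<open>Quantal response equilibrium. The Gibbs form is stated by logarithms up to a normalizing
  constant, as \<open>kl_gibbs\<close> and \<open>kl_mirror_step\<close> expect it; the min player
  is written as a max player with payoffs \<open>- M a b\<close>.\<close>

definition qre :: "'a set \<Rightarrow> 'b set \<Rightarrow> real \<Rightarrow> ('a \<Rightarrow> 'b \<Rightarrow> real) \<Rightarrow> ('a \<Rightarrow> real) \<Rightarrow> ('b \<Rightarrow> real) \<Rightarrow> bool" where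
  "qre A B \<tau> M p q \<longleftrightarrow> prob_vec A p \<and> prob_vec B q \<and> (\<forall>a\<in>A. 0 < p a) \<and> (\<forall>b\<in>B. 0 < q b) \<and>
     (\<exists>c. \<forall>a\<in>A. \<tau> * ln (p a) = (\<Sum>b\<in>B. M a b * q b) - c) \<and>
     (\<exists>d. \<forall>b\<in>B. \<tau> * ln (q b) = (\<Sum>a\<in>A. - M a b * p a) - d)"

text \<open>At an equilibrium the first-order terms vanish, so the expansion is exact with only a
  cross term and two divergences left. Fixing one player at equilibrium kills the cross term and
  gives the saddle inequalities.\<close>

lemma f_reg_qre:
  assumes e: "qre A B \<tau> M \<mu> \<nu>" and p: "prob_vec A p" and q: "prob_vec B q"
  shows "f_reg A B \<tau> M p q = f_reg A B \<tau> M \<mu> \<nu> + bilin A B M (\<lambda>a. p a - \<mu> a) (\<lambda>b. q b - \<nu> b)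
           - \<tau> * kl A p \<mu> + \<tau> * kl B q \<nu>"
proof -
  obtain c d where c: "\<And>a. a \<in> A \<Longrightarrow> \<tau> * ln (\<mu> a) = (\<Sum>b\<in>B. M a b * \<nu> b) - c"
    and d: "\<And>b. b \<in> B \<Longrightarrow> \<tau> * ln (\<nu> b) = (\<Sum>a\<in>A. - M a b * \<mu> a) - d"
    using e by (auto simp: qre_def)
  have s: "sum \<mu> A = 1" "sum \<nu> B = 1" "sum p A = 1" "sum q B = 1"
    using e p q by (auto simp: qre_def prob_vec_def)
  have neg: "(\<Sum>b\<in>B. q b * (\<Sum>a\<in>A. - M a b * \<mu> a)) = - bilin A B M \<mu> q" for q
    by (simp add: bilin_right sum_negf)
  show ?thesis
    using kl_gibbs[where m = \<mu>, OF c s(3)] kl_gibbs[where m = \<nu>, OF d s(4)]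
      entropy_gibbs[where m = \<mu>, OF c s(1)] entropy_gibbs[where m = \<nu>, OF d s(2)]
    unfolding neg unfolding bilin_diff f_reg_bilin bilin_left[symmetric] by simp
qed

text \<open>Strategies are total functions, and without the condition that they vanish off
  \<open>I\<close> the set would be unbounded in the product topology. With it, Tychonoff applies to
  a product of \<open>{0..1}\<close> and \<open>{0}\<close>, cut by a closed hyperplane.\<close>

lemma compact_simplex:
  "compact {p :: 'i \<Rightarrow> real. (\<forall>i\<in>I. 0 \<le> p i) \<and> (\<forall>i. i \<notin> I \<longrightarrow> p i = 0) \<and> sum p I = 1}"
    if fin: "finite I"
proof -
  let ?X = "\<lambda>i. if i \<in> I then {0..1::real} else {0}"
  have 1: "compact (PiE UNIV ?X)"
    using compactin_PiE[of "\<lambda>_::'i. euclideanreal" UNIV ?X] by (simp add: euclidean_product_topology)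
  have "closed {p :: 'i \<Rightarrow> real. sum p I = 1}"
    by (intro closed_Collect_eq continuous_intros continuous_on_product_coordinates)
  with 1 have "compact (PiE UNIV ?X \<inter> {p. sum p I = 1})"
    by (rule compact_Int_closed)
  also have "PiE UNIV ?X \<inter> {p. sum p I = 1}
      = {p. (\<forall>i\<in>I. 0 \<le> p i) \<and> (\<forall>i. i \<notin> I \<longrightarrow> p i = 0) \<and> sum p I = 1}"
  proof (intro equalityI subsetI)
    fix p :: "'i \<Rightarrow> real" assume "p \<in> {p. (\<forall>i\<in>I. 0 \<le> p i) \<and> (\<forall>i. i \<notin> I \<longrightarrow> p i = 0) \<and> sum p I = 1}"
    then have p: "\<forall>i\<in>I. 0 \<le> p i" "\<forall>i. i \<notin> I \<longrightarrow> p i = 0" "sum p I = 1"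
      by auto
    then have "p i \<le> 1" if "i \<in> I" for i
      using member_le_sum[of i I p] that fin by auto
    with p show "p \<in> PiE UNIV ?X \<inter> {p. sum p I = 1}" by auto
  qed (fastforce simp: PiE_iff split: if_splits)+
  finally show ?thesis .
qed

text \<open>The max player's guaranteed payoff attains its maximum over the simplex. As the
  payoff is concave, moving from a maximizer towards any \<open>p\<close> and letting the step tend to zero
  (with continuously varying best responses) shows that the maximizer and its best response form
  a saddle point, hence are best responses to each other.\<close>

lemma qre_exists:
  assumes fin: "finite A" "A \<noteq> {}" "finite B" "B \<noteq> {}" and \<tau>: "0 < \<tau>"
  shows "\<exists>p q. qre A B \<tau> M p q"
proof -
  define S where "S = {p. (\<forall>i\<in>A. 0 \<le> p i) \<and> (\<forall>i. i \<notin> A \<longrightarrow> p i = 0) \<and> sum p A = (1::real)}"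
  define w where "w p b = exp ((\<Sum>a\<in>A. - M a b * p a) / \<tau>)" for p b
  define n where "n p = normalized B (w p)" for p
  let ?f = "f_reg A B \<tau> M"
  have wpos: "0 < sum (w p) B" for p
    using fin by (intro sum_pos) (auto simp: w_def)
  have n: "prob_vec B (n p)" "\<And>b. b \<in> B \<Longrightarrow> 0 < n p b"
    "\<And>b. b \<in> B \<Longrightarrow> \<tau> * ln (n p b) = (\<Sum>a\<in>A. - M a b * p a) - \<tau> * ln (sum (w p) B)" for p
    using normalized_pos[OF fin(3,4), of "w p"] \<tau> unfolding n_def
    by (auto simp: w_def right_diff_distrib)
  have min: "?f p (n p) \<le> ?f p q" if "prob_vec B q" for p q
  proof -
    have s: "sum q B = 1" "sum (n p) B = 1" using that n(1) by (auto simp: prob_vec_def)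
    have neg: "(\<Sum>b\<in>B. q b * (\<Sum>a\<in>A. - M a b * p a)) = - bilin A B M p q" for q
      by (simp add: bilin_right sum_negf)
    have "?f p q = ?f p (n p) + \<tau> * kl B q (n p)"
      using kl_gibbs[where m = "n p", OF n(3) s(1)] entropy_gibbs[where m = "n p", OF n(3) s(2)] unfolding neg f_reg_bilin by simp
    moreover have "0 \<le> kl B q (n p)"
      using n(2)[of _ p] by (intro kl_nonneg that n(1)) force
    ultimately show ?thesis using \<tau> by simp
  qed
  have SD: "p \<in> S \<Longrightarrow> prob_vec A p" for p by (auto simp: S_def prob_vec_def)
  have cS: "compact S" unfolding S_def by (rule compact_simplex[OF fin(1)])
  have ent: "continuous_on T (\<lambda>x. entropy I (h x))"
    if "\<And>i x. i \<in> I \<Longrightarrow> x \<in> T \<Longrightarrow> 0 \<le> h x i" "\<And>i. i \<in> I \<Longrightarrow> continuous_on T (\<lambda>x. h x i)"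
    for T :: "'z::topological_space set" and I :: "'i set" and h
    unfolding entropy_def using that
    by (intro continuous_on_minus continuous_on_sum continuous_on_compose2[OF continuous_on_x_ln_x]) auto
  have "continuous_on S (\<lambda>p. ?f p (n p))"
  proof -
    have c1: "continuous_on S (\<lambda>p. p a)" for a
      by (rule continuous_on_subset[OF continuous_on_product_coordinates]) simp
    have c2: "continuous_on S (\<lambda>p. n p b)" for b
      using wpos \<tau> unfolding n_def normalized_def w_def
      by (intro continuous_intros c1) (auto simp: w_def less_le)
    have "0 \<le> n x b" if "b \<in> B" for x b
      using n(2)[OF that] by (simp add: less_imp_le)
    then show ?thesis unfolding f_reg_bilin bilin_def
      by (intro continuous_intros c1 c2 ent) (auto simp: S_def)
  qed
  moreover have "(\<lambda>a. if a \<in> A then uniform A a else 0) \<in> S"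
    using fin by (auto simp: S_def uniform_def)
  ultimately obtain \<mu> where \<mu>: "\<mu> \<in> S" and max: "\<And>p. p \<in> S \<Longrightarrow> ?f p (n p) \<le> ?f \<mu> (n \<mu>)"
    using continuous_attains_sup[OF cS, of "\<lambda>p. ?f p (n p)"] by blast
  define \<nu> where "\<nu> = n \<mu>"
  have saddle: "?f p \<nu> \<le> ?f \<mu> \<nu>" if p: "p \<in> S" for p
  proof -
    define m where "m t = (\<lambda>i. (1 - t) * \<mu> i + t * p i)" for t
    have le: "?f p (n (m t)) \<le> ?f \<mu> \<nu>" if t: "0 < t" "t < 1" for t
    proof -
      have "m t \<in> S" using p \<mu> t by (auto simp: S_def m_def sum.distrib sum_distrib_left[symmetric])
      have "(1 - t) * ?f \<mu> \<nu> \<le> (1 - t) * ?f \<mu> (n (m t))"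
        using t min[OF n(1)] unfolding \<nu>_def by (intro mult_left_mono) auto
      moreover have "(1 - t) * ?f \<mu> (n (m t)) + t * ?f p (n (m t)) \<le> ?f (m t) (n (m t))"
        using mult_left_mono[OF entropy_concave[OF SD[OF \<mu>] SD[OF p] t], of \<tau>] \<tau>
        unfolding f_reg_bilin m_def bilin_add_left by (simp add: algebra_simps)
      moreover have "?f (m t) (n (m t)) \<le> ?f \<mu> \<nu>"
        unfolding \<nu>_def by (rule max) fact
      ultimately have "t * ?f p (n (m t)) \<le> t * ?f \<mu> \<nu>" by (simp add: algebra_simps)
      then show ?thesis using t by simp
    qed
    have "continuous_on UNIV (\<lambda>t. ?f p (n (m t)))"
    proof -
      have c2: "continuous_on UNIV (\<lambda>t. n (m t) b)" for b
        using wpos \<tau> unfolding n_def normalized_def w_def m_def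
        by (intro continuous_intros) (auto simp: w_def less_le)
      have "0 \<le> n x b" if "b \<in> B" for x b
        using n(2)[OF that] by (simp add: less_imp_le)
      then show ?thesis unfolding f_reg_bilin bilin_def
        by (intro continuous_intros c2 ent) auto
    qed
    then have "((\<lambda>t. ?f p (n (m t))) \<longlongrightarrow> ?f p (n (m 0))) (at 0 within UNIV)"
      unfolding continuous_on_def by blast
    then have "((\<lambda>t. ?f p (n (m t))) \<longlongrightarrow> ?f p (n (m 0))) (at_right 0)"
      by (rule tendsto_within_subset) simp
    moreover have "eventually (\<lambda>t. ?f p (n (m t)) \<le> ?f \<mu> \<nu>) (at_right (0::real))"
      using le by (auto simp: eventually_at_right_field intro!: exI[of _ 1])
    moreover have "m 0 = \<mu>" by (simp add: m_def)
    ultimately show ?thesis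
      unfolding \<nu>_def by (intro tendsto_upperbound[where F="at_right 0"]) auto
  qed
  define v where "v a = (\<Sum>b\<in>B. M a b * \<nu> b)" for a
  define m where "m = normalized A (\<lambda>a. exp (v a / \<tau>))"
  define c where "c = \<tau> * ln (\<Sum>a\<in>A. exp (v a / \<tau>))"
  have m: "prob_vec A m" "\<And>a. a \<in> A \<Longrightarrow> 0 < m a" "\<And>a. a \<in> A \<Longrightarrow> \<tau> * ln (m a) = v a - c"
    using normalized_pos[OF fin(1,2), of "\<lambda>a. exp (v a / \<tau>)"] \<tau>
    unfolding m_def[symmetric] by (auto simp: c_def right_diff_distrib)
  \<comment> \<open>The saddle inequality is known only on \<open>S\<close>, whose members vanish
    off \<open>A\<close>, so the Gibbs response is truncated before it is used as a
    competitor.\<close>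
  define m' where "m' a = (if a \<in> A then m a else 0)" for a
  have "?f m' \<nu> \<le> ?f \<mu> \<nu>"
    using m by (intro saddle) (auto simp: S_def m'_def prob_vec_def)
  also have "?f m' \<nu> = ?f m \<nu>"
    by (simp add: f_reg_def entropy_def m'_def)
  finally have le: "?f m \<nu> \<le> ?f \<mu> \<nu>" .
  have s: "sum \<mu> A = 1" "sum m A = 1" using \<mu> m(1) by (auto simp: prob_vec_def S_def)
  \<comment> \<open>The payoff that \<mu> loses against the Gibbs response \<open>m\<close> is
    exactly this divergence. It is at most 0 by the saddle inequality, and Pinsker turns that into
    equality on \<open>A\<close>.\<close>
  have "\<tau> * kl A \<mu> m = ?f m \<nu> - ?f \<mu> \<nu>"
    using kl_gibbs[where m = m, OF m(3) s(1)] entropy_gibbs[where m = m, OF m(3) s(2)]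
    unfolding f_reg_bilin bilin_left v_def by simp
  with le have "\<tau> * kl A \<mu> m \<le> 0" by simp
  then have "kl A \<mu> m \<le> 0" using \<tau> by (simp add: mult_le_0_iff)
  with pinsker[OF SD[OF \<mu>] m(1,2)] have "(l1_dist A \<mu> m)\<^sup>2 \<le> 0" by linarith
  then have "l1_dist A \<mu> m = 0" by (metis power2_less_eq_zero_iff)
  then have eq: "\<mu> a = m a" if "a \<in> A" for a
    using that fin by (simp add: l1_dist_def sum_nonneg_eq_0_iff)
  have "qre A B \<tau> M \<mu> \<nu>"
    unfolding qre_def
  proof (intro conjI ballI)
    show "prob_vec A \<mu>" by (rule SD) fact
    show "prob_vec B \<nu>" "\<And>b. b \<in> B \<Longrightarrow> 0 < \<nu> b" unfolding \<nu>_def by (fact n)+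
    show "0 < \<mu> a" if "a \<in> A" for a using eq m that by simp
    show "\<exists>c. \<forall>a\<in>A. \<tau> * ln (\<mu> a) = (\<Sum>b\<in>B. M a b * \<nu> b) - c"
      using eq m(3) unfolding v_def by (intro exI[of _ c]) simp
    show "\<exists>d. \<forall>b\<in>B. \<tau> * ln (\<nu> b) = (\<Sum>a\<in>A. - M a b * \<mu> a) - d"
      using n(3)[of _ \<mu>] unfolding \<nu>_def by blast
  qed
  then show ?thesis by blast
qed

section \<open>Values of regularized games and their dependence on the payoffs\<close>

text \<open>The choice is harmless: by the saddle inequalities all equilibria of a game have the
  same payoff.\<close>

definition game_value :: "'a set \<Rightarrow> 'b set \<Rightarrow> real \<Rightarrow> ('a \<Rightarrow> 'b \<Rightarrow> real) \<Rightarrow> real" where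
  "game_value A B \<tau> M = (SOME v. \<exists>p q. qre A B \<tau> M p q \<and> v = f_reg A B \<tau> M p q)"

lemma game_value_qre:
  assumes "finite A" "A \<noteq> {}" "finite B" "B \<noteq> {}" "0 < \<tau>"
  obtains p q where "qre A B \<tau> M p q" "game_value A B \<tau> M = f_reg A B \<tau> M p q"
  using someI_ex[of "\<lambda>v. \<exists>p q. qre A B \<tau> M p q \<and> v = f_reg A B \<tau> M p q"] qre_exists[OF assms]
  unfolding game_value_def by blast

lemma qre_saddle:
  assumes "qre A B \<tau> M \<mu> \<nu>" "0 < \<tau>"
  shows "prob_vec A p \<Longrightarrow> f_reg A B \<tau> M p \<nu> \<le> f_reg A B \<tau> M \<mu> \<nu>"
    and "prob_vec B q \<Longrightarrow> f_reg A B \<tau> M \<mu> \<nu> \<le> f_reg A B \<tau> M \<mu> q"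
proof -
  have e: "prob_vec A \<mu>" "prob_vec B \<nu>" "\<forall>a\<in>A. 0 < \<mu> a" "\<forall>b\<in>B. 0 < \<nu> b"
    using assms by (auto simp: qre_def)
  have z: "bilin A B M p (\<lambda>b. 0) = 0" "bilin A B M (\<lambda>a. 0) q = 0" for p q
    by (simp_all add: bilin_def)
  have k: "prob_vec A p \<Longrightarrow> 0 \<le> \<tau> * kl A p \<mu>" "prob_vec B q \<Longrightarrow> 0 \<le> \<tau> * kl B q \<nu>" for p q
    using e assms(2) by (auto intro!: mult_nonneg_nonneg kl_nonneg simp: less_imp_le)
  show "prob_vec A p \<Longrightarrow> f_reg A B \<tau> M p \<nu> \<le> f_reg A B \<tau> M \<mu> \<nu>"
    using f_reg_qre[OF assms(1) _ e(2)] k(1) by (simp add: z)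
  show "prob_vec B q \<Longrightarrow> f_reg A B \<tau> M \<mu> \<nu> \<le> f_reg A B \<tau> M \<mu> q"
    using f_reg_qre[OF assms(1) e(1)] k(2) by (simp add: z)
qed

lemma bilin_mono:
  assumes "prob_vec A p" "prob_vec B q" "\<And>a b. a \<in> A \<Longrightarrow> b \<in> B \<Longrightarrow> M a b \<le> M' a b + d"
  shows "bilin A B M p q \<le> bilin A B M' p q + d"
proof -
  have "bilin A B M p q \<le> (\<Sum>a\<in>A. \<Sum>b\<in>B. p a * (M' a b + d) * q b)"
    unfolding bilin_def using assms
    by (intro sum_mono mult_right_mono mult_left_mono) (auto simp: prob_vec_def)
  also have "\<dots> = bilin A B M' p q + (\<Sum>a\<in>A. \<Sum>b\<in>B. p a * (q b * d))"
    by (simp add: bilin_def sum.distrib algebra_simps)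
  also have "(\<Sum>a\<in>A. \<Sum>b\<in>B. p a * (q b * d)) = (\<Sum>a\<in>A. p a) * ((\<Sum>b\<in>B. q b) * d)"
    by (subst sum_distrib_right[of q B d]) (rule sum_product[symmetric])
  finally show ?thesis using assms by (simp add: prob_vec_def)
qed

text \<open>Both games are compared at the crossed pair \<open>p\<close>, \<open>q'\<close>:
  replacing \<open>q\<close> by \<open>q'\<close> raises the payoff in the first game, and replacing
  \<open>p'\<close> by \<open>p\<close> lowers it in the second. Used in both directions, this makes
  the value 1-Lipschitz in the maximum norm.\<close>

lemma game_value_mono:
  assumes fin: "finite A" "A \<noteq> {}" "finite B" "B \<noteq> {}" "0 < \<tau>"
    and le: "\<And>a b. a \<in> A \<Longrightarrow> b \<in> B \<Longrightarrow> M a b \<le> M' a b + d"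
  shows "game_value A B \<tau> M \<le> game_value A B \<tau> M' + d"
proof -
  obtain p q where pq: "qre A B \<tau> M p q" "game_value A B \<tau> M = f_reg A B \<tau> M p q"
    using game_value_qre[OF fin] .
  obtain p' q' where pq': "qre A B \<tau> M' p' q'" "game_value A B \<tau> M' = f_reg A B \<tau> M' p' q'"
    using game_value_qre[OF fin] .
  have v: "prob_vec A p" "prob_vec B q'" using pq pq' by (auto simp: qre_def)
  have "f_reg A B \<tau> M p q \<le> f_reg A B \<tau> M p q'"
    using qre_saddle(2)[OF pq(1) fin(5)] v by blast
  also have "\<dots> \<le> f_reg A B \<tau> M' p q' + d"
    using bilin_mono[OF v le] by (simp add: f_reg_bilin)
  also have "\<dots> \<le> f_reg A B \<tau> M' p' q' + d"
    using qre_saddle(1)[OF pq'(1) fin(5)] v by simp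
  finally show ?thesis using pq pq' by simp
qed

text \<open>Only the entropies are left to play for, and both players maximize theirs by the uniform
  strategy. The result is the common shift that regularization adds to every game value.\<close>

lemma game_value_const:
  assumes fin: "finite A" "A \<noteq> {}" "finite B" "B \<noteq> {}" "0 < \<tau>"
  shows "game_value A B \<tau> (\<lambda>_ _. c) = c + \<tau> * (ln (card A) - ln (card B))"
proof -
  obtain p q where pq: "qre A B \<tau> (\<lambda>_ _. c) p q" "game_value A B \<tau> (\<lambda>_ _. c) = f_reg A B \<tau> (\<lambda>_ _. c) p q"
    using game_value_qre[OF fin] .
  have v: "prob_vec A p" "prob_vec B q" using pq by (auto simp: qre_def)
  have b: "f_reg A B \<tau> (\<lambda>_ _. c) p q = c + \<tau> * entropy A p - \<tau> * entropy B q"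
    if "prob_vec A p" "prob_vec B q" for p q
    using that unfolding f_reg_bilin bilin_left
    by (simp add: prob_vec_def sum_distrib_left[symmetric] sum_distrib_right[symmetric])
  have u: "prob_vec A (uniform A)" "prob_vec B (uniform B)" using fin prob_vec_uniform by auto
  show ?thesis
    using qre_saddle(1)[OF pq(1) fin(5) u(1)] qre_saddle(2)[OF pq(1) fin(5) u(2)] pq(2)
      mult_left_mono[OF entropy_le_ln_card[OF v(1) fin(1,2)], of \<tau>]
      mult_left_mono[OF entropy_le_ln_card[OF v(2) fin(3,4)], of \<tau>] fin(5)
    by (simp add: b v u entropy_uniform[OF fin(1,2)] entropy_uniform[OF fin(3,4)] algebra_simps)
qed

subsection \<open>Convergence of PU and OMWU\<close>

lemma l1_dist_nonneg: "0 \<le> l1_dist I p q"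
  by (simp add: l1_dist_def sum_nonneg)

lemma l1_dist_commute: "l1_dist I p q = l1_dist I q p"
  by (simp add: l1_dist_def abs_minus_commute)

lemma l1_dist_triangle: "l1_dist I p r \<le> l1_dist I p q + l1_dist I q r"
  unfolding l1_dist_def sum.distrib[symmetric] by (intro sum_mono) simp

text \<open>Only the oscillation of the payoffs matters, because differences of strategies have
  zero total mass.\<close>

lemma bilin_diff_bound:
  assumes M: "\<And>a b. a \<in> A \<Longrightarrow> b \<in> B \<Longrightarrow> lo \<le> M a b \<and> M a b \<le> lo + W"
    and q: "sum q B = sum q' B"
  shows "\<bar>bilin A B M (\<lambda>a. p a - p' a) (\<lambda>b. q b - q' b)\<bar> \<le> W / 2 * l1_dist A p p' * l1_dist B q q'"
proof -
  \<comment> \<open>Centring the payoffs at the midpoint of their range bounds them by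
    \<open>W / 2\<close>; this is the source of the factor 1/2.\<close>
  let ?N = "\<lambda>a b. M a b - (lo + W / 2)"
  have 0: "(\<Sum>b\<in>B. q b - q' b) = 0" using q by (simp add: sum_subtractf)
  have "(\<Sum>b\<in>B. ?N a b * (q b - q' b)) = (\<Sum>b\<in>B. M a b * (q b - q' b))" for a
  proof -
    have "(\<Sum>b\<in>B. ?N a b * (q b - q' b))
        = (\<Sum>b\<in>B. M a b * (q b - q' b)) - (lo + W / 2) * (\<Sum>b\<in>B. q b - q' b)"
      by (simp add: sum_distrib_left sum_subtractf[symmetric] algebra_simps del: sum_subtractf)
    then show ?thesis by (simp add: 0)
  qed
  then have "bilin A B M (\<lambda>a. p a - p' a) (\<lambda>b. q b - q' b) = bilin A B ?N (\<lambda>a. p a - p' a) (\<lambda>b. q b - q' b)"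
    by (simp add: bilin_left)
  also have "\<bar>\<dots>\<bar> \<le> (\<Sum>a\<in>A. \<Sum>b\<in>B. \<bar>p a - p' a\<bar> * (W / 2) * \<bar>q b - q' b\<bar>)"
    unfolding bilin_def
  proof (intro order_trans[OF sum_abs] sum_mono order_trans[OF sum_abs])
    fix a b assume "a \<in> A" "b \<in> B"
    then have "\<bar>?N a b\<bar> \<le> W / 2" "0 \<le> W" using M[of a b] by (auto simp: abs_le_iff field_simps)
    then show "\<bar>(p a - p' a) * ?N a b * (q b - q' b)\<bar> \<le> \<bar>p a - p' a\<bar> * (W / 2) * \<bar>q b - q' b\<bar>"
      unfolding abs_mult by (intro mult_mono) auto
  qed
  also have "\<dots> = W / 2 * l1_dist A p p' * l1_dist B q q'"
    unfolding l1_dist_def by (simp add: sum_distrib_left sum_distrib_right sum_divide_distrib mult_ac)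
  finally show ?thesis .
qed

lemma max_update:
  fixes \<eta> \<tau> :: real
  assumes "finite A" "A \<noteq> {}" "\<And>a. a \<in> A \<Longrightarrow> 0 < p a"
  shows "prob_vec A (max_update A B \<eta> \<tau> M p q)"
    "\<And>a. a \<in> A \<Longrightarrow> 0 < max_update A B \<eta> \<tau> M p q a"
    "\<exists>c. \<forall>a\<in>A. ln (max_update A B \<eta> \<tau> M p q a) = (1 - \<eta> * \<tau>) * ln (p a) + \<eta> * (\<Sum>b\<in>B. M a b * q b) - c"
proof -
  let ?w = "\<lambda>a. p a powr (1 - \<eta> * \<tau>) * exp (\<eta> * (\<Sum>b\<in>B. M a b * q b))"
  have w: "0 < ?w a" if "a \<in> A" for a using assms(3)[OF that] by simp
  note n = normalized_pos[where w = ?w, OF assms(1,2), folded max_update_def]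
  show "prob_vec A (max_update A B \<eta> \<tau> M p q)" using w by (rule n(1))
  show "0 < max_update A B \<eta> \<tau> M p q a" if "a \<in> A" for a using w that by (rule n(2))
  have "ln (?w a) = (1 - \<eta> * \<tau>) * ln (p a) + \<eta> * (\<Sum>b\<in>B. M a b * q b)" if "a \<in> A" for a
    using assms(3)[OF that] by (simp add: ln_mult ln_powr)
  then show "\<exists>c. \<forall>a\<in>A. ln (max_update A B \<eta> \<tau> M p q a)
      = (1 - \<eta> * \<tau>) * ln (p a) + \<eta> * (\<Sum>b\<in>B. M a b * q b) - c"
    using n(3) w by (intro exI[of _ "ln (sum ?w A)"]) simp
qed

text \<open>The min player is a max player in the game with negated, transposed payoffs, so the
  facts about \<open>max_update\<close> serve both.\<close>

lemma min_update_eq: "min_update A B \<eta> \<tau> M q p = max_update B A \<eta> \<tau> (\<lambda>b a. - M a b) q p"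
  by (simp add: min_update_def max_update_def sum_negf)

definition interior_iterate :: "'a set \<Rightarrow> 'b set \<Rightarrow> ('a, 'b) iterate \<Rightarrow> bool" where
  "interior_iterate A B = (\<lambda>(\<mu>, \<nu>, \<mu>b, \<nu>b).
     prob_vec A \<mu> \<and> prob_vec B \<nu> \<and> prob_vec A \<mu>b \<and> prob_vec B \<nu>b \<and>
     (\<forall>a\<in>A. 0 < \<mu> a \<and> 0 < \<mu>b a) \<and> (\<forall>b\<in>B. 0 < \<nu> b \<and> 0 < \<nu>b b))"

text \<open>The bounds \<open>1 / 5\<close> and \<open>9 / 16\<close> are what the prescribed
  learning rate yields for the oscillation of the iterates. They guarantee \<open>\<eta> * W / 2
  \<le> (1 - \<eta> * \<tau>) * (1 - \<eta> * W)\<close> and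
  \<open>1 / 2 \<le> 1 - \<eta> * \<tau> - \<eta> * W / 2\<close>.\<close>

locale regularized_game =
  fixes A :: "'a set" and B :: "'b set" and \<eta> \<tau> :: real and M :: "'a \<Rightarrow> 'b \<Rightarrow> real"
    and lo W :: real and \<mu>s :: "'a \<Rightarrow> real" and \<nu>s :: "'b \<Rightarrow> real"
  assumes fin: "finite A" "A \<noteq> {}" "finite B" "B \<noteq> {}"
    and \<eta>: "0 < \<eta>" and \<tau>: "0 < \<tau>" and step: "\<eta> * \<tau> \<le> 1 / 5" "\<eta> * W \<le> 9 / 16"
    and M: "\<And>a b. a \<in> A \<Longrightarrow> b \<in> B \<Longrightarrow> lo \<le> M a b \<and> M a b \<le> lo + W"
    and eq: "qre A B \<tau> M \<mu>s \<nu>s"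
begin

lemma W_nonneg: "0 \<le> W"
proof -
  obtain a b where "a \<in> A" "b \<in> B" using fin by blast
  with M[of a b] show ?thesis by linarith
qed

text \<open>The weight \<open>1 - \<eta> * W\<close> is what is left of the divergence between
  update and prediction after it has paid for the prediction errors of its own step. This remainder
  pays for the OMWU errors of the next step, which start from the old prediction.\<close>

definition potential :: "('a, 'b) iterate \<Rightarrow> real" where
  "potential = (\<lambda>(\<mu>, \<nu>, \<mu>b, \<nu>b). kl A \<mu>s \<mu> + kl B \<nu>s \<nu> + (1 - \<eta> * W) * (kl A \<mu> \<mu>b + kl B \<nu> \<nu>b))"

text \<open>Pinsker plus the inequality of arithmetic and geometric means. PU predicts from the base
  point, at distance \<open>l1_dist I p pb'\<close>; OMWU predicts from the previous
  \<open>pb\<close>, and the triangle inequality through \<open>p\<close> adds the term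
  \<open>kl I p pb\<close>. Here \<open>l\<close> is the distance of one player's update from the
  prediction, and \<open>p\<close>, \<open>pb\<close>, \<open>pb'\<close> belong to the
  opponent.\<close>

lemma prediction_error:
  assumes "l \<le> sqrt (2 * k)" "0 \<le> l" "0 \<le> k"
    and "prob_vec I p" "prob_vec I pb" "prob_vec I pb'"
    and pos: "\<And>i. i \<in> I \<Longrightarrow> 0 < p i" "\<And>i. i \<in> I \<Longrightarrow> 0 < pb i" "\<And>i. i \<in> I \<Longrightarrow> 0 < pb' i"
  shows "l * l1_dist I (case alg of PU \<Rightarrow> p | OMWU \<Rightarrow> pb) pb' \<le> kl I p pb + kl I pb' p + 2 * k"
proof -
  have l2: "l\<^sup>2 \<le> 2 * k" using assms by (metis real_le_rsqrt sqrt_le_D real_sqrt_le_iff power_mono real_sqrt_pow2 mult_nonneg_nonneg zero_le_numeral)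
  have am: "l * d \<le> k + y" if "d\<^sup>2 \<le> 2 * y" for d y
  proof -
    have "0 \<le> (l - d)\<^sup>2" by simp
    then show ?thesis using that l2 by (simp add: power2_eq_square algebra_simps)
  qed
  have 1: "l * l1_dist I p pb' \<le> k + kl I pb' p"
    using assms by (subst l1_dist_commute) (intro am pinsker)
  have 2: "l * l1_dist I pb p \<le> k + kl I p pb"
    using assms by (subst l1_dist_commute) (intro am pinsker)
  have nn: "0 \<le> kl I p pb" using assms by (intro kl_nonneg) (auto simp: less_le)
  show ?thesis
  proof (cases alg)
    case PU
    then show ?thesis using 1 nn assms(3) by simp
  next
    case OMWU
    have "l * l1_dist I pb pb' \<le> l * (l1_dist I pb p + l1_dist I p pb')"
      using assms(2) by (intro mult_left_mono l1_dist_triangle)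
    with OMWU 1 2 show ?thesis by (simp add: algebra_simps)
  qed
qed

text \<open>The mirror-step identities of the two players are added. Their bilinear terms relative
  to the equilibrium cancel because the game is zero-sum, and the other two are prediction errors
  absorbed by the negative divergences. The surplus divergences are kept on the left because they
  control the value gap.\<close>

lemma solver_step_bound:
  assumes z: "interior_iterate A B (\<mu>, \<nu>, \<mu>b, \<nu>b)"
    and z': "solver_step alg A B \<eta> \<tau> M (\<mu>, \<nu>, \<mu>b, \<nu>b) = (\<mu>', \<nu>', \<mu>b', \<nu>b')"
  shows "interior_iterate A B (\<mu>', \<nu>', \<mu>b', \<nu>b')"
    and "potential (\<mu>', \<nu>', \<mu>b', \<nu>b') + \<eta> * \<tau> * (kl A \<mu>b' \<mu>s + kl B \<nu>b' \<nu>s)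
           + (1 - \<eta> * \<tau> - \<eta> * W / 2) * (kl A \<mu>b' \<mu> + kl B \<nu>b' \<nu>)
         \<le> (1 - \<eta> * \<tau>) * potential (\<mu>, \<nu>, \<mu>b, \<nu>b)"
proof -
  define p where "p = (case alg of PU \<Rightarrow> \<mu> | OMWU \<Rightarrow> \<mu>b)"
  define q where "q = (case alg of PU \<Rightarrow> \<nu> | OMWU \<Rightarrow> \<nu>b)"
  let ?N = "\<lambda>b a. - M a b"
  have upd: "\<mu>b' = max_update A B \<eta> \<tau> M \<mu> q" "\<nu>b' = max_update B A \<eta> \<tau> ?N \<nu> p"
    "\<mu>' = max_update A B \<eta> \<tau> M \<mu> \<nu>b'" "\<nu>' = max_update B A \<eta> \<tau> ?N \<nu> \<mu>b'"
    using z' by (auto simp: Let_def p_def q_def min_update_eq)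
  have pos: "\<And>a. a \<in> A \<Longrightarrow> 0 < \<mu> a" "\<And>b. b \<in> B \<Longrightarrow> 0 < \<nu> b" "\<And>a. a \<in> A \<Longrightarrow> 0 < \<mu>b a" "\<And>b. b \<in> B \<Longrightarrow> 0 < \<nu>b b"
    and pv: "prob_vec A \<mu>" "prob_vec B \<nu>" "prob_vec A \<mu>b" "prob_vec B \<nu>b"
    using z by (auto simp: interior_iterate_def)
  note A = max_update[where p = \<mu> and B = B and \<eta> = \<eta> and \<tau> = \<tau> and M = M, OF fin(1,2) pos(1)]
  note B = max_update[where p = \<nu> and B = A and \<eta> = \<eta> and \<tau> = \<tau> and M = ?N, OF fin(3,4) pos(2)]
  have pv': "prob_vec A \<mu>b'" "prob_vec B \<nu>b'" "prob_vec A \<mu>'" "prob_vec B \<nu>'"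
    unfolding upd by (simp_all add: A(1) B(1))
  have pos': "\<And>a. a \<in> A \<Longrightarrow> 0 < \<mu>' a" "\<And>b. b \<in> B \<Longrightarrow> 0 < \<nu>' b" "\<And>a. a \<in> A \<Longrightarrow> 0 < \<mu>b' a" "\<And>b. b \<in> B \<Longrightarrow> 0 < \<nu>b' b"
    unfolding upd by (simp_all add: A(2) B(2))
  show "interior_iterate A B (\<mu>', \<nu>', \<mu>b', \<nu>b')"
    using pv' pos' by (simp add: interior_iterate_def)
  have pvs: "prob_vec A \<mu>s" "prob_vec B \<nu>s" using eq by (auto simp: qre_def)
  obtain cs ds where cs: "\<And>a. a \<in> A \<Longrightarrow> \<tau> * ln (\<mu>s a) = (\<Sum>b\<in>B. M a b * \<nu>s b) - cs"
    and ds: "\<And>b. b \<in> B \<Longrightarrow> \<tau> * ln (\<nu>s b) = (\<Sum>a\<in>A. - M a b * \<mu>s a) - ds"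
    using eq by (auto simp: qre_def)
  obtain cb where cb: "\<And>a. a \<in> A \<Longrightarrow> ln (\<mu>b' a) = (1 - \<eta> * \<tau>) * ln (\<mu> a) + \<eta> * (\<Sum>b\<in>B. M a b * q b) - cb"
    using A(3)[where q = "q"] unfolding upd(1)[symmetric] by blast
  obtain c' where c': "\<And>a. a \<in> A \<Longrightarrow> ln (\<mu>' a) = (1 - \<eta> * \<tau>) * ln (\<mu> a) + \<eta> * (\<Sum>b\<in>B. M a b * \<nu>b' b) - c'"
    using A(3)[where q = "\<nu>b'"] unfolding upd(3)[symmetric] by blast
  obtain db where db: "\<And>b. b \<in> B \<Longrightarrow> ln (\<nu>b' b) = (1 - \<eta> * \<tau>) * ln (\<nu> b) + \<eta> * (\<Sum>a\<in>A. - M a b * p a) - db"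
    using B(3)[where q = "p"] unfolding upd(2)[symmetric] by blast
  obtain d' where d': "\<And>b. b \<in> B \<Longrightarrow> ln (\<nu>' b) = (1 - \<eta> * \<tau>) * ln (\<nu> b) + \<eta> * (\<Sum>a\<in>A. - M a b * \<mu>b' a) - d'"
    using B(3)[where q = "\<mu>b'"] unfolding upd(4)[symmetric] by blast
  have sA: "(\<Sum>a\<in>A. ((\<Sum>b\<in>B. M a b * y b) - (\<Sum>b\<in>B. M a b * y' b)) * (x a - x' a))
      = bilin A B M (\<lambda>a. x a - x' a) (\<lambda>b. y b - y' b)" for x x' y y'
    unfolding bilin_left by (simp add: sum_subtractf right_diff_distrib mult.commute)
  have sB: "(\<Sum>b\<in>B. ((\<Sum>a\<in>A. - M a b * x a) - (\<Sum>a\<in>A. - M a b * x' a)) * (y b - y' b))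
      = - bilin A B M (\<lambda>a. x a - x' a) (\<lambda>b. y b - y' b)" for x x' y y'
    unfolding bilin_right
    by (simp add: sum_subtractf right_diff_distrib sum_negf sum.distrib algebra_simps)
  have sums: "sum \<mu>' A = 1" "sum \<mu>b' A = 1" "sum \<mu>s A = 1" "sum \<nu>' B = 1" "sum \<nu>b' B = 1" "sum \<nu>s B = 1"
    using pv' pvs by (auto simp: prob_vec_def)
  have stepA: "kl A \<mu>s \<mu>' = (1 - \<eta> * \<tau>) * kl A \<mu>s \<mu> - (1 - \<eta> * \<tau>) * kl A \<mu>b' \<mu> - \<eta> * \<tau> * kl A \<mu>b' \<mu>s
      - kl A \<mu>' \<mu>b' + \<eta> * bilin A B M (\<lambda>a. \<mu>b' a - \<mu>' a) (\<lambda>b. q b - \<nu>b' b)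
      + \<eta> * bilin A B M (\<lambda>a. \<mu>b' a - \<mu>s a) (\<lambda>b. \<nu>b' b - \<nu>s b)"
    using kl_mirror_step[where p = \<mu> and p' = \<mu>' and pb = \<mu>b' and ps = \<mu>s, OF c' cb cs sums(1-3)] unfolding sA .
  have stepB: "kl B \<nu>s \<nu>' = (1 - \<eta> * \<tau>) * kl B \<nu>s \<nu> - (1 - \<eta> * \<tau>) * kl B \<nu>b' \<nu> - \<eta> * \<tau> * kl B \<nu>b' \<nu>s
      - kl B \<nu>' \<nu>b' + \<eta> * - bilin A B M (\<lambda>a. p a - \<mu>b' a) (\<lambda>b. \<nu>b' b - \<nu>' b)
      + \<eta> * - bilin A B M (\<lambda>a. \<mu>b' a - \<mu>s a) (\<lambda>b. \<nu>b' b - \<nu>s b)"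
    using kl_mirror_step[where p = \<nu> and p' = \<nu>' and pb = \<nu>b' and ps = \<nu>s, OF d' db ds sums(4-6)] unfolding sB .
  have nnk: "0 \<le> kl A \<mu>' \<mu>b'" "0 \<le> kl B \<nu>' \<nu>b'" "0 \<le> kl A \<mu> \<mu>b" "0 \<le> kl B \<nu> \<nu>b"
    using pv pv' pos pos' by (auto intro!: kl_nonneg simp: less_le)
  have lA: "l1_dist A \<mu>b' \<mu>' \<le> sqrt (2 * kl A \<mu>' \<mu>b')"
    using pinsker[OF pv'(3,1) pos'(3)] by (simp add: l1_dist_commute real_le_rsqrt)
  have lB: "l1_dist B \<nu>b' \<nu>' \<le> sqrt (2 * kl B \<nu>' \<nu>b')"
    using pinsker[OF pv'(4,2) pos'(4)] by (simp add: l1_dist_commute real_le_rsqrt)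
  have sq: "sum q B = 1" using pv by (auto simp: q_def prob_vec_def split: inner_solver.split)
  have "bilin A B M (\<lambda>a. \<mu>b' a - \<mu>' a) (\<lambda>b. q b - \<nu>b' b)
      \<le> W / 2 * (l1_dist A \<mu>b' \<mu>' * l1_dist B q \<nu>b')"
    using bilin_diff_bound[where A = A and B = B and M = M and p = \<mu>b' and p' = \<mu>' and q = q and q' = \<nu>b', OF M] sq sums by simp
  also have "\<dots> \<le> W / 2 * (kl B \<nu> \<nu>b + kl B \<nu>b' \<nu> + 2 * kl A \<mu>' \<mu>b')"
    unfolding q_def using W_nonneg
    by (intro mult_left_mono prediction_error lA l1_dist_nonneg nnk pv pv' pos pos') auto
  finally have bA: "\<eta> * bilin A B M (\<lambda>a. \<mu>b' a - \<mu>' a) (\<lambda>b. q b - \<nu>b' b)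
      \<le> \<eta> * (W / 2 * (kl B \<nu> \<nu>b + kl B \<nu>b' \<nu> + 2 * kl A \<mu>' \<mu>b'))"
    using \<eta> by (intro mult_left_mono) auto
  have "- bilin A B M (\<lambda>a. p a - \<mu>b' a) (\<lambda>b. \<nu>b' b - \<nu>' b)
      \<le> W / 2 * (l1_dist B \<nu>b' \<nu>' * l1_dist A p \<mu>b')"
    using bilin_diff_bound[where A = A and B = B and M = M and p = p and p' = \<mu>b' and q = \<nu>b' and q' = \<nu>', OF M] sums
    by (simp add: mult_ac abs_le_iff)
  also have "\<dots> \<le> W / 2 * (kl A \<mu> \<mu>b + kl A \<mu>b' \<mu> + 2 * kl B \<nu>' \<nu>b')"
    unfolding p_def using W_nonneg
    by (intro mult_left_mono prediction_error lB l1_dist_nonneg nnk pv pv' pos pos') auto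
  finally have bB: "\<eta> * - bilin A B M (\<lambda>a. p a - \<mu>b' a) (\<lambda>b. \<nu>b' b - \<nu>' b)
      \<le> \<eta> * (W / 2 * (kl A \<mu> \<mu>b + kl A \<mu>b' \<mu> + 2 * kl B \<nu>' \<nu>b'))"
    using \<eta> by (intro mult_left_mono) auto
  \<comment> \<open>Charge for the old prediction against the share of the old potential that is
    available: at most 9/32 against at least 7/20.\<close>
  have key: "\<eta> * W / 2 \<le> (1 - \<eta> * \<tau>) * (1 - \<eta> * W)"
  proof -
    have "(4 / 5) * (7 / 16) \<le> (1 - \<eta> * \<tau>) * (1 - \<eta> * W)"
      using step by (intro mult_mono) auto
    then show ?thesis using step by simp
  qed
  have "\<eta> * W / 2 * (kl A \<mu> \<mu>b + kl B \<nu> \<nu>b) \<le> (1 - \<eta> * \<tau>) * (1 - \<eta> * W) * (kl A \<mu> \<mu>b + kl B \<nu> \<nu>b)"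
    using nnk by (intro mult_right_mono key) auto
  then show "potential (\<mu>', \<nu>', \<mu>b', \<nu>b') + \<eta> * \<tau> * (kl A \<mu>b' \<mu>s + kl B \<nu>b' \<nu>s)
           + (1 - \<eta> * \<tau> - \<eta> * W / 2) * (kl A \<mu>b' \<mu> + kl B \<nu>b' \<nu>)
         \<le> (1 - \<eta> * \<tau>) * potential (\<mu>, \<nu>, \<mu>b, \<nu>b)"
    using stepA stepB bA bB by (simp add: potential_def algebra_simps)
qed

text \<open>In the expansion of \<open>f_reg_qre\<close> the divergences come multiplied by \<tau>,
  and \<open>\<eta> * \<tau> * K\<close> is among the terms kept by
  \<open>solver_step_bound\<close>. Bounding the cross term by \<open>K\<close> as well would cost a
  factor 1 / \<tau>. Instead the distance from prediction to equilibrium is measured through \<mu>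
  and \<nu>: the divergence of the prediction from them is kept with a coefficient of at least 1/2,
  and that of the equilibrium is part of the potential.\<close>

lemma solver_step_gap:
  assumes z: "interior_iterate A B (\<mu>, \<nu>, \<mu>b, \<nu>b)"
    and z': "solver_step alg A B \<eta> \<tau> M (\<mu>, \<nu>, \<mu>b, \<nu>b) = (\<mu>', \<nu>', \<mu>b', \<nu>b')"
  shows "\<bar>f_reg A B \<tau> M \<mu>b' \<nu>b' - f_reg A B \<tau> M \<mu>s \<nu>s\<bar> \<le> 3 / \<eta> * potential (\<mu>, \<nu>, \<mu>b, \<nu>b)"
    and "potential (\<mu>', \<nu>', \<mu>b', \<nu>b') \<le> (1 - \<eta> * \<tau>) * potential (\<mu>, \<nu>, \<mu>b, \<nu>b)"
proof -
  define \<phi> where "\<phi> = potential (\<mu>, \<nu>, \<mu>b, \<nu>b)"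
  define K where "K = kl A \<mu>b' \<mu>s + kl B \<nu>b' \<nu>s"
  define \<beta> where "\<beta> = kl A \<mu>b' \<mu> + kl B \<nu>b' \<nu>"
  note b = solver_step_bound[OF z z']
  have pv: "prob_vec A \<mu>" "prob_vec B \<nu>" "prob_vec A \<mu>b" "prob_vec B \<nu>b" "prob_vec A \<mu>s" "prob_vec B \<nu>s"
      "prob_vec A \<mu>'" "prob_vec B \<nu>'" "prob_vec A \<mu>b'" "prob_vec B \<nu>b'"
    and pos: "\<forall>a\<in>A. 0 < \<mu> a \<and> 0 < \<mu>b a \<and> 0 < \<mu>' a \<and> 0 < \<mu>b' a \<and> 0 < \<mu>s a"
      "\<forall>b\<in>B. 0 < \<nu> b \<and> 0 < \<nu>b b \<and> 0 < \<nu>' b \<and> 0 < \<nu>b' b \<and> 0 < \<nu>s b"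
    using z b(1) eq by (auto simp: interior_iterate_def qre_def)
  have KA: "0 \<le> kl A \<mu>b' \<mu>s" "0 \<le> kl A \<mu>b' \<mu>" "0 \<le> kl A \<mu>' \<mu>b'" "0 \<le> kl A \<mu> \<mu>b" "0 \<le> kl A \<mu>s \<mu>'" "0 \<le> kl A \<mu>s \<mu>"
    using pv pos(1) by (auto intro!: kl_nonneg simp: less_le)
  have KB: "0 \<le> kl B \<nu>b' \<nu>s" "0 \<le> kl B \<nu>b' \<nu>" "0 \<le> kl B \<nu>' \<nu>b'" "0 \<le> kl B \<nu> \<nu>b" "0 \<le> kl B \<nu>s \<nu>'" "0 \<le> kl B \<nu>s \<nu>"
    using pv pos(2) by (auto intro!: kl_nonneg simp: less_le)
  have s: "0 < \<eta> * \<tau>" "0 \<le> \<eta> * W" using \<eta> \<tau> W_nonneg by auto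
  have nn: "0 \<le> K" "0 \<le> \<beta>" "0 \<le> potential (\<mu>', \<nu>', \<mu>b', \<nu>b')" "0 \<le> \<phi>"
    "0 \<le> \<eta> * \<tau> * K" "0 \<le> (1 - \<eta> * \<tau> - \<eta> * W / 2) * \<beta>"
    using KA KB step s by (auto simp: K_def \<beta>_def \<phi>_def potential_def intro!: add_nonneg_nonneg mult_nonneg_nonneg)
  have b': "potential (\<mu>', \<nu>', \<mu>b', \<nu>b') + \<eta> * \<tau> * K + (1 - \<eta> * \<tau> - \<eta> * W / 2) * \<beta> \<le> (1 - \<eta> * \<tau>) * \<phi>"
    using b(2) by (simp add: K_def \<beta>_def \<phi>_def)
  then show "potential (\<mu>', \<nu>', \<mu>b', \<nu>b') \<le> (1 - \<eta> * \<tau>) * potential (\<mu>, \<nu>, \<mu>b, \<nu>b)"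
    using nn by (simp add: \<phi>_def)
  have \<phi>le: "(1 - \<eta> * \<tau>) * \<phi> \<le> \<phi>" using mult_right_mono[of "1 - \<eta> * \<tau>" 1 \<phi>] nn s by simp
  have K\<phi>: "\<eta> * \<tau> * K \<le> \<phi>" using b' \<phi>le nn by linarith
  have "1 / 2 * \<beta> \<le> (1 - \<eta> * \<tau> - \<eta> * W / 2) * \<beta>"
    using nn step by (intro mult_right_mono) auto
  then have \<beta>\<phi>: "\<beta> \<le> 2 * \<phi>" using b' \<phi>le nn by linarith
  have l1: "(l1_dist I p q)\<^sup>2 \<le> 4 * kl I p r + 4 * kl I q r"
    if "prob_vec I p" "prob_vec I q" "prob_vec I r" "\<And>i. i \<in> I \<Longrightarrow> 0 < r i" for I :: "'z set" and p q r
  proof -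
    let ?x = "l1_dist I p r" and ?y = "l1_dist I q r"
    have "(l1_dist I p q)\<^sup>2 \<le> (?x + ?y)\<^sup>2"
      using l1_dist_triangle[of I p q r] by (intro power_mono) (auto simp: l1_dist_commute l1_dist_nonneg)
    also have "\<dots> \<le> 2 * ?x\<^sup>2 + 2 * ?y\<^sup>2"
      using zero_le_power2[of "?x - ?y"] by (simp add: power2_eq_square algebra_simps)
    finally show ?thesis using pinsker[OF that(1,3,4)] pinsker[OF that(2,3,4)] by simp
  qed
  have "\<bar>bilin A B M (\<lambda>a. \<mu>b' a - \<mu>s a) (\<lambda>b. \<nu>b' b - \<nu>s b)\<bar>
      \<le> W / 2 * (l1_dist A \<mu>b' \<mu>s * l1_dist B \<nu>b' \<nu>s)"
    using bilin_diff_bound[where A = A and B = B and M = M and p = \<mu>b' and p' = \<mu>s and q = \<nu>b' and q' = \<nu>s, OF M] pv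
    by (simp add: mult.assoc prob_vec_def)
  also have "\<dots> \<le> W / 2 * (2 * \<beta> + 2 * \<phi>)"
  proof (intro mult_left_mono)
    have "0 \<le> (l1_dist A \<mu>b' \<mu>s - l1_dist B \<nu>b' \<nu>s)\<^sup>2" by simp
    then have "l1_dist A \<mu>b' \<mu>s * l1_dist B \<nu>b' \<nu>s \<le> ((l1_dist A \<mu>b' \<mu>s)\<^sup>2 + (l1_dist B \<nu>b' \<nu>s)\<^sup>2) / 2"
      by (simp add: power2_eq_square algebra_simps)
    also have "\<dots> \<le> 2 * \<beta> + 2 * (kl A \<mu>s \<mu> + kl B \<nu>s \<nu>)"
      using l1[of A \<mu>b' \<mu>s \<mu>] l1[of B \<nu>b' \<nu>s \<nu>] pv pos by (simp add: \<beta>_def)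
    also have "\<dots> \<le> 2 * \<beta> + 2 * \<phi>"
      using KA KB step by (simp add: \<phi>_def potential_def mult_nonneg_nonneg)
    finally show "l1_dist A \<mu>b' \<mu>s * l1_dist B \<nu>b' \<nu>s \<le> 2 * \<beta> + 2 * \<phi>" .
  qed (use W_nonneg in auto)
  also have "\<dots> \<le> W / 2 * (6 * \<phi>)"
    using \<beta>\<phi> W_nonneg by (intro mult_left_mono) auto
  finally have "\<eta> * \<bar>bilin A B M (\<lambda>a. \<mu>b' a - \<mu>s a) (\<lambda>b. \<nu>b' b - \<nu>s b)\<bar> \<le> \<eta> * (W / 2 * (6 * \<phi>))"
    using \<eta> by (intro mult_left_mono) auto
  \<comment> \<open>The cross term contributes 27/16, rounded up to 2; the divergences weighted by
    \<tau> contribute 1. Together they give the 3 in \<open>3 / \<eta>\<close>.\<close>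
  also have "\<dots> = 3 * (\<eta> * W) * \<phi>" by simp
  also have "\<dots> \<le> 3 * (9 / 16) * \<phi>" using step nn by (intro mult_right_mono mult_left_mono) auto
  finally have bil: "\<eta> * \<bar>bilin A B M (\<lambda>a. \<mu>b' a - \<mu>s a) (\<lambda>b. \<nu>b' b - \<nu>s b)\<bar> \<le> 2 * \<phi>"
    using nn by simp
  let ?G = "f_reg A B \<tau> M \<mu>b' \<nu>b' - f_reg A B \<tau> M \<mu>s \<nu>s"
  have "?G = bilin A B M (\<lambda>a. \<mu>b' a - \<mu>s a) (\<lambda>b. \<nu>b' b - \<nu>s b) - \<tau> * kl A \<mu>b' \<mu>s + \<tau> * kl B \<nu>b' \<nu>s"
    using f_reg_qre[OF eq pv(9,10)] by simp
  moreover have "0 \<le> \<tau> * kl A \<mu>b' \<mu>s" "0 \<le> \<tau> * kl B \<nu>b' \<nu>s" using \<tau> KA KB by auto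
  ultimately have "\<bar>?G\<bar> \<le> \<bar>bilin A B M (\<lambda>a. \<mu>b' a - \<mu>s a) (\<lambda>b. \<nu>b' b - \<nu>s b)\<bar> + \<tau> * K"
    unfolding K_def distrib_left by linarith
  then have "\<eta> * \<bar>?G\<bar> \<le> \<eta> * (\<bar>bilin A B M (\<lambda>a. \<mu>b' a - \<mu>s a) (\<lambda>b. \<nu>b' b - \<nu>s b)\<bar> + \<tau> * K)"
    using \<eta> by (intro mult_left_mono) auto
  also have "\<dots> \<le> 3 * \<phi>" using bil K\<phi> by (simp add: algebra_simps)
  finally show "\<bar>?G\<bar> \<le> 3 / \<eta> * potential (\<mu>, \<nu>, \<mu>b, \<nu>b)"
    using \<eta> by (simp add: \<phi>_def field_simps)
qed

lemma solver_iterate_bound: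
  "interior_iterate A B (solver_iterate alg A B \<eta> \<tau> M k)
    \<and> potential (solver_iterate alg A B \<eta> \<tau> M k) \<le> (1 - \<eta> * \<tau>) ^ k * (ln (card A) + ln (card B))"
proof (induction k)
  case 0
  have pvs: "prob_vec A \<mu>s" "prob_vec B \<nu>s" using eq by (auto simp: qre_def)
  \<comment> \<open>Initially base point and prediction coincide, so only the divergences of the
    equilibrium from the uniform strategies count.\<close>
  have "kl A \<mu>s (uniform A) \<le> ln (card A)" "kl B \<nu>s (uniform B) \<le> ln (card B)"
    using kl_uniform[OF pvs(1) fin(1,2)] kl_uniform[OF pvs(2) fin(3,4)]
      entropy_nonneg[OF pvs(1) fin(1)] entropy_nonneg[OF pvs(2) fin(3)] by auto
  moreover have "0 < uniform A a" "0 < uniform B b" for a b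
    using fin by (auto simp: uniform_def card_gt_0_iff)
  ultimately show ?case
    using fin by (simp add: solver_iterate_def potential_def interior_iterate_def prob_vec_uniform)
next
  case (Suc k)
  obtain \<mu> \<nu> \<mu>b \<nu>b where z: "solver_iterate alg A B \<eta> \<tau> M k = (\<mu>, \<nu>, \<mu>b, \<nu>b)" by (metis surj_pair)
  obtain \<mu>' \<nu>' \<mu>b' \<nu>b' where z': "solver_step alg A B \<eta> \<tau> M (\<mu>, \<nu>, \<mu>b, \<nu>b) = (\<mu>', \<nu>', \<mu>b', \<nu>b')"
    by (metis surj_pair)
  have s: "solver_iterate alg A B \<eta> \<tau> M (Suc k) = (\<mu>', \<nu>', \<mu>b', \<nu>b')"
    using z z' by (simp add: solver_iterate_def)
  have i: "interior_iterate A B (\<mu>, \<nu>, \<mu>b, \<nu>b)" using Suc z by simp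
  have "potential (\<mu>', \<nu>', \<mu>b', \<nu>b') \<le> (1 - \<eta> * \<tau>) * potential (\<mu>, \<nu>, \<mu>b, \<nu>b)"
    by (rule solver_step_gap(2)[OF i z'])
  also have "\<dots> \<le> (1 - \<eta> * \<tau>) * ((1 - \<eta> * \<tau>) ^ k * (ln (card A) + ln (card B)))"
    using Suc z step by (intro mult_left_mono) auto
  finally show ?case using solver_step_bound(1)[OF i z'] s by (simp add: mult.assoc)
qed

text \<open>The index shift arises because the prediction made in step \<open>Suc k\<close> is
  controlled by the potential before that step.\<close>

lemma solver_iterate_gap:
  "(case solver_iterate alg A B \<eta> \<tau> M (Suc k) of (_, _, \<mu>b, \<nu>b) \<Rightarrow>
      \<bar>f_reg A B \<tau> M \<mu>b \<nu>b - f_reg A B \<tau> M \<mu>s \<nu>s\<bar>)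
    \<le> 3 / \<eta> * ((1 - \<eta> * \<tau>) ^ k * (ln (card A) + ln (card B)))"
proof -
  obtain \<mu> \<nu> \<mu>b \<nu>b where z: "solver_iterate alg A B \<eta> \<tau> M k = (\<mu>, \<nu>, \<mu>b, \<nu>b)" by (metis surj_pair)
  obtain \<mu>' \<nu>' \<mu>b' \<nu>b' where z': "solver_step alg A B \<eta> \<tau> M (\<mu>, \<nu>, \<mu>b, \<nu>b) = (\<mu>', \<nu>', \<mu>b', \<nu>b')"
    by (metis surj_pair)
  have s: "solver_iterate alg A B \<eta> \<tau> M (Suc k) = (\<mu>', \<nu>', \<mu>b', \<nu>b')"
    using z z' by (simp add: solver_iterate_def)
  have "\<bar>f_reg A B \<tau> M \<mu>b' \<nu>b' - f_reg A B \<tau> M \<mu>s \<nu>s\<bar> \<le> 3 / \<eta> * potential (\<mu>, \<nu>, \<mu>b, \<nu>b)"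
    using solver_iterate_bound[of alg k] z by (intro solver_step_gap(1)[OF _ z']) auto
  also have "\<dots> \<le> 3 / \<eta> * ((1 - \<eta> * \<tau>) ^ k * (ln (card A) + ln (card B)))"
    using solver_iterate_bound[of alg k] z \<eta> by (intro mult_left_mono) auto
  finally show ?thesis by (simp add: s)
qed

end

lemma approx_value_error:
  assumes fin: "finite A" "A \<noteq> {}" "finite B" "B \<noteq> {}"
    and "0 < \<eta>" "0 < \<tau>" "\<eta> * \<tau> \<le> 1 / 5" "\<eta> * W \<le> 9 / 16"
    and "\<And>a b. a \<in> A \<Longrightarrow> b \<in> B \<Longrightarrow> lo \<le> Q s a b \<and> Q s a b \<le> lo + W"
  shows "\<bar>approx_value alg A B \<eta> \<tau> (Suc k) Q s - game_value A B \<tau> (Q s)\<bar>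
           \<le> 3 / \<eta> * ((1 - \<eta> * \<tau>) ^ k * (ln (card A) + ln (card B)))"
proof -
  obtain p q where pq: "qre A B \<tau> (Q s) p q" "game_value A B \<tau> (Q s) = f_reg A B \<tau> (Q s) p q"
    using game_value_qre[OF fin \<open>0 < \<tau>\<close>] .
  interpret regularized_game A B \<eta> \<tau> "Q s" lo W p q
    using assms pq by unfold_locales
  show ?thesis
    using solver_iterate_gap[of alg k] pq(2) by (simp add: approx_value_def split: prod.splits)
qed

subsection \<open>The Bellman equation for soft values\<close>

primrec step_law ::
  "('s \<Rightarrow> 'a \<Rightarrow> 'b \<Rightarrow> 's pmf) \<Rightarrow> ('s \<Rightarrow> 'a pmf) \<Rightarrow> ('s \<Rightarrow> 'b pmf) \<Rightarrow> nat \<Rightarrow> 's \<Rightarrow> ('s \<times> 'a \<times> 'b) pmf"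
where
  "step_law P \<mu> \<nu> 0 s = play \<mu> \<nu> s"
| "step_law P \<mu> \<nu> (Suc n) s
     = bind_pmf (step_law P \<mu> \<nu> n s) (\<lambda>(s', a, b). bind_pmf (P s' a b) (play \<mu> \<nu>))"

text \<open>\<open>step_law\<close> appends transitions at the end, as the trajectory kernel does,
  whereas the Bellman equation splits off the first one. Associativity of \<open>bind_pmf\<close>
  mediates.\<close>

lemma step_law_Suc_first:
  "step_law P \<mu> \<nu> (Suc n) s
     = bind_pmf (play \<mu> \<nu> s) (\<lambda>(s', a, b). bind_pmf (P s' a b) (step_law P \<mu> \<nu> n))"
proof (induction n)
  case 0
  show ?case by (simp add: case_prod_unfold)
next
  case (Suc n)
  have eta: "step_law P \<mu> \<nu> (Suc n) = (\<lambda>s. bind_pmf (step_law P \<mu> \<nu> n s)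
      (\<lambda>(s', a, b). bind_pmf (P s' a b) (play \<mu> \<nu>)))"
    by (rule ext) simp
  show ?case
    by (subst step_law.simps(2), subst Suc, subst eta)
       (simp add: bind_assoc_pmf case_prod_unfold del: step_law.simps)
qed

section \<open>Marginals of the trajectory law\<close>

text \<open>Each coordinate is determined by a finite composition of kernels. The second equation
  produces coordinate \<open>Suc n\<close> from the composition up to \<open>Suc n\<close>, and the
  first identifies the last coordinate of that composition with coordinate \<open>n\<close> of the
  limit; together they drive the induction in \<open>distr_trajectory_law\<close>.\<close>

lemma (in Ionescu_Tulcea) distr_lim_component:
  "distr PF.lim (M n) (\<lambda>\<omega>. \<omega> n) = distr (C 0 (Suc n) (\<lambda>_. undefined)) (M n) (\<lambda>\<omega>. \<omega> n)"
  "distr PF.lim (M n) (\<lambda>\<omega>. \<omega> n) = C 0 n (\<lambda>_. undefined) \<bind> P n"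
proof -
  let ?u = "\<lambda>_::nat. undefined" and ?J = "{0..<Suc n}"
  have u: "?u \<in> space (PiM {0..<0} M)" by simp
  have up: "up_to ?J = Suc n"
    unfolding up_to_def by (rule Least_equality) (force simp: not_less_eq_eq)+
  have comp: "(\<lambda>\<omega>. \<omega> n) \<in> measurable (PiM ?J M) (M n)"
    by (rule measurable_component_singleton) simp
  have "distr PF.lim (M n) (\<lambda>\<omega>. \<omega> n)
      = distr (distr PF.lim (PiM ?J M) (\<lambda>x. restrict x ?J)) (M n) (\<lambda>\<omega>. \<omega> n)"
    by (subst distr_distr[OF comp])
       (auto intro!: measurable_restrict_subset simp: measurable_cong_sets[OF PF.sets_lim] comp_def)
  also have "\<dots> = distr (distr (C 0 (Suc n) ?u) (PiM ?J M) (\<lambda>x. restrict x ?J)) (M n) (\<lambda>\<omega>. \<omega> n)"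
    by (subst distr_lim) (simp_all add: CI_def up)
  also have "\<dots> = distr (C 0 (Suc n) ?u) (M n) (\<lambda>\<omega>. \<omega> n)"
  proof -
    have "(\<lambda>x. restrict x ?J) \<in> measurable (C 0 (Suc n) ?u) (PiM ?J M)"
      using sets_C[OF u, of "Suc n"] by (subst measurable_cong_sets) (auto intro!: measurable_restrict_subset)
    then show ?thesis by (subst distr_distr[OF comp]) (simp_all add: comp_def)
  qed
  finally show eq: "distr PF.lim (M n) (\<lambda>\<omega>. \<omega> n) = distr (C 0 (Suc n) ?u) (M n) (\<lambda>\<omega>. \<omega> n)" .
  also have "\<dots> = distr (C 0 n ?u \<bind> eP n) (M n) (\<lambda>\<omega>. \<omega> n)" by simp
  also have "\<dots> = C 0 n ?u \<bind> (\<lambda>\<omega>. distr (eP n \<omega>) (M n) (\<lambda>\<omega>. \<omega> n))"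
  proof (rule distr_bind[OF _ _ comp])
    show "eP n \<in> measurable (C 0 n ?u) (subprob_algebra (PiM ?J M))"
      using sets_C[OF u, of n] measurable_eP[of n] by (simp cong: measurable_cong_sets)
    show "space (C 0 n ?u) \<noteq> {}" using prob_space_C[OF u] by (rule prob_space.not_empty)
  qed
  also have "\<dots> = C 0 n ?u \<bind> P n"
  proof (rule bind_cong[OF refl])
    fix \<omega> assume "\<omega> \<in> space (C 0 n ?u)"
    then have \<omega>: "\<omega> \<in> space (PiM {0..<n} M)" using space_C[OF u, of n] by simp
    have m: "fun_upd \<omega> n \<in> measurable (P n \<omega>) (PiM ?J M)"
      using \<omega> by (intro measurable_fun_upd[where J = "{0..<n}"])
        (auto simp: sets_P[OF \<omega>] intro!: measurable_ident_sets)
    show "distr (eP n \<omega>) (M n) (\<lambda>\<omega>. \<omega> n) = P n \<omega>"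
      unfolding eP_def by (subst distr_distr[OF comp m]) (simp add: comp_def distr_id2 sets_P[OF \<omega>])
  qed
  finally show "distr PF.lim (M n) (\<lambda>\<omega>. \<omega> n) = C 0 n (\<lambda>_. undefined) \<bind> P n" .
qed

lemma distr_trajectory_law:
  "distr (trajectory_law P \<mu> \<nu> s) (count_space UNIV) (\<lambda>\<omega>. \<omega> n) = measure_pmf (step_law P \<mu> \<nu> n s)"
proof -
  interpret IT: Ionescu_Tulcea "trajectory_kernel P \<mu> \<nu> s" "\<lambda>_. count_space UNIV"
    by (rule Ionescu_Tulcea_trajectory_kernel)
  let ?u = "\<lambda>_::nat. undefined" and ?X = "\<lambda>n. PiM {0..<n} (\<lambda>_. count_space UNIV)"
  have u: "?u \<in> space (?X 0)" by simp
  let ?k = "\<lambda>x. measure_pmf (case x of (s', a, b) \<Rightarrow> bind_pmf (P s' a b) (play \<mu> \<nu>))"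
  have D: "distr IT.PF.lim (count_space UNIV) (\<lambda>\<omega>. \<omega> n) = measure_pmf (step_law P \<mu> \<nu> n s)"
  proof (induction n)
    case 0
    have "distr IT.PF.lim (count_space UNIV) (\<lambda>\<omega>. \<omega> 0) = return (?X 0) ?u \<bind> trajectory_kernel P \<mu> \<nu> s 0"
      by (subst IT.distr_lim_component(2)) simp
    also have "\<dots> = trajectory_kernel P \<mu> \<nu> s 0 ?u"
      by (rule bind_return[OF IT.P u])
    also have "\<dots> = measure_pmf (step_law P \<mu> \<nu> 0 s)"
      by (simp add: trajectory_kernel_def)
    finally show ?case .
  next
    case (Suc n)
    have kern: "trajectory_kernel P \<mu> \<nu> s (Suc n) = (\<lambda>\<omega>. ?k (\<omega> n))"
      by (simp add: trajectory_kernel_def[abs_def])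
    have k: "?k \<in> measurable (count_space UNIV) (subprob_algebra (count_space UNIV))"
      by (auto simp: space_subprob_algebra measure_pmf.subprob_space_axioms)
    have "distr IT.PF.lim (count_space UNIV) (\<lambda>\<omega>. \<omega> (Suc n)) = IT.C 0 (Suc n) ?u \<bind> (\<lambda>\<omega>. ?k (\<omega> n))"
      by (subst IT.distr_lim_component(2)) (simp only: kern)
    also have "\<dots> = distr (IT.C 0 (Suc n) ?u) (count_space UNIV) (\<lambda>\<omega>. \<omega> n) \<bind> ?k"
    proof (rule bind_distr[symmetric, OF _ k])
      show "(\<lambda>\<omega>. \<omega> n) \<in> measurable (IT.C 0 (Suc n) ?u) (count_space UNIV)"
        using IT.sets_C[OF u, of "Suc n"]
        by (subst measurable_cong_sets[OF _ refl]) (auto intro!: measurable_component_singleton)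
      show "space (IT.C 0 (Suc n) ?u) \<noteq> {}"
        using IT.prob_space_C[OF u] by (rule prob_space.not_empty)
    qed
    also have "distr (IT.C 0 (Suc n) ?u) (count_space UNIV) (\<lambda>\<omega>. \<omega> n)
        = distr IT.PF.lim (count_space UNIV) (\<lambda>\<omega>. \<omega> n)"
      by (rule IT.distr_lim_component(1)[symmetric])
    also have "\<dots> = measure_pmf (step_law P \<mu> \<nu> n s)" by (rule Suc)
    also have "\<dots> \<bind> ?k = measure_pmf (step_law P \<mu> \<nu> (Suc n) s)"
      by (simp add: measure_pmf_bind case_prod_unfold)
    finally show ?case .
  qed
  then show ?thesis by (simp add: trajectory_law_def)
qed

lemma measurable_component_trajectory_law:
  "(\<lambda>\<omega>. \<omega> n) \<in> measurable (trajectory_law P \<mu> \<nu> s) (count_space UNIV)"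
proof -
  interpret IT: Ionescu_Tulcea "trajectory_kernel P \<mu> \<nu> s" "\<lambda>_. count_space UNIV"
    by (rule Ionescu_Tulcea_trajectory_kernel)
  show ?thesis unfolding trajectory_law_def
    by (subst measurable_cong_sets[OF IT.PF.sets_lim refl]) (rule measurable_component_singleton, simp)
qed

lemma AE_trajectory_law:
  "AE \<omega> in trajectory_law P \<mu> \<nu> s. \<omega> n \<in> set_pmf (step_law P \<mu> \<nu> n s)"
proof -
  have "AE x in distr (trajectory_law P \<mu> \<nu> s) (count_space UNIV) (\<lambda>\<omega>. \<omega> n). x \<in> set_pmf (step_law P \<mu> \<nu> n s)"
    unfolding distr_trajectory_law by (rule AE_measure_pmf)
  then show ?thesis
    by (subst (asm) AE_distr_iff) (auto intro: measurable_component_trajectory_law)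
qed

lemma prob_space_trajectory_law: "prob_space (trajectory_law P \<mu> \<nu> s)"
  by (rule prob_space_distrD[OF measurable_component_trajectory_law[of 0]])
     (simp add: distr_trajectory_law measure_pmf.prob_space_axioms)

lemma integral_trajectory_law:
  fixes f :: "_ \<Rightarrow> real"
  shows "(\<integral>\<omega>. f (\<omega> n) \<partial>trajectory_law P \<mu> \<nu> s) = measure_pmf.expectation (step_law P \<mu> \<nu> n s) f"
    and "integrable (trajectory_law P \<mu> \<nu> s) (\<lambda>\<omega>. f (\<omega> n)) \<longleftrightarrow> integrable (step_law P \<mu> \<nu> n s) f"
  using integral_distr[OF measurable_component_trajectory_law[of n P \<mu> \<nu> s], of f]
    integrable_distr_eq[OF measurable_component_trajectory_law[of n P \<mu> \<nu> s], of f]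
  by (simp_all add: distr_trajectory_law)

section \<open>The Bellman equation for a fixed pair of policies\<close>

locale soft_markov_game =
  fixes S :: "'s set" and A :: "'a set" and B :: "'b set"
    and P :: "'s \<Rightarrow> 'a \<Rightarrow> 'b \<Rightarrow> 's pmf" and r :: "'s \<Rightarrow> 'a \<Rightarrow> 'b \<Rightarrow> real" and \<gamma> \<tau> :: real
  assumes game: "markov_game S A B P r \<gamma>" and \<tau>: "0 < \<tau>"
begin

lemma fin: "finite S" "S \<noteq> {}" "finite A" "A \<noteq> {}" "finite B" "B \<noteq> {}"
  and \<gamma>: "0 \<le> \<gamma>" "\<gamma> < 1"
  and r: "\<And>s a b. s \<in> S \<Longrightarrow> a \<in> A \<Longrightarrow> b \<in> B \<Longrightarrow> 0 \<le> r s a b"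
    "\<And>s a b. s \<in> S \<Longrightarrow> a \<in> A \<Longrightarrow> b \<in> B \<Longrightarrow> r s a b \<le> 1"
  and P: "\<And>s a b. s \<in> S \<Longrightarrow> a \<in> A \<Longrightarrow> b \<in> B \<Longrightarrow> set_pmf (P s a b) \<subseteq> S"
  using game by (auto simp: markov_game_def)

lemma expectation_P:
  assumes "s \<in> S" "a \<in> A" "b \<in> B"
  shows "measure_pmf.expectation (P s a b) V = (\<Sum>s'\<in>S. pmf (P s a b) s' * V s')"
  using P[OF assms] by (subst integral_measure_pmf[OF fin(1)]) auto

lemma backup_mono:
  assumes "s \<in> S" "a \<in> A" "b \<in> B" and le: "\<And>s'. s' \<in> S \<Longrightarrow> V s' \<le> V' s' + d"
  shows "backup P r \<gamma> V s a b \<le> backup P r \<gamma> V' s a b + \<gamma> * d"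
proof -
  have "(\<Sum>s'\<in>S. pmf (P s a b) s' * V s') \<le> (\<Sum>s'\<in>S. pmf (P s a b) s' * (V' s' + d))"
    by (intro sum_mono mult_left_mono le) auto
  also have "\<dots> = (\<Sum>s'\<in>S. pmf (P s a b) s' * V' s') + (\<Sum>s'\<in>S. pmf (P s a b) s') * d"
    by (simp add: distrib_left sum.distrib sum_distrib_right)
  also have "(\<Sum>s'\<in>S. pmf (P s a b) s') = 1"
    using P[OF assms(1-3)] fin(1) by (rule sum_pmf_eq_1[rotated])
  finally show ?thesis
    using \<gamma> mult_left_mono[of _ _ \<gamma>] by (fastforce simp: backup_def expectation_P[OF assms(1-3)] algebra_simps)
qed

lemma backup_const: "backup P r \<gamma> (\<lambda>_. c) s a b = r s a b + \<gamma> * c"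
  by (simp add: backup_def)

lemma prob_vec_policy:
  assumes "\<mu> \<in> policies S I" "s \<in> S" "finite I"
  shows "prob_vec I (pmf (\<mu> s))"
  using assms sum_pmf_eq_1[of I "\<mu> s"] by (auto simp: prob_vec_def policies_def)

context
  fixes \<mu> :: "'s \<Rightarrow> 'a pmf" and \<nu> :: "'s \<Rightarrow> 'b pmf"
  assumes \<mu>: "\<mu> \<in> policies S A" and \<nu>: "\<nu> \<in> policies S B"
begin

lemma set_play: "s \<in> S \<Longrightarrow> set_pmf (play \<mu> \<nu> s) \<subseteq> S \<times> A \<times> B"
  using \<mu> \<nu> by (force simp: play_def policies_def)

lemma set_step_law: "s \<in> S \<Longrightarrow> set_pmf (step_law P \<mu> \<nu> n s) \<subseteq> S \<times> A \<times> B"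
proof (induction n)
  case (Suc n)
  show ?case
  proof
    fix x assume "x \<in> set_pmf (step_law P \<mu> \<nu> (Suc n) s)"
    then obtain s1 a b s2 where "(s1, a, b) \<in> set_pmf (step_law P \<mu> \<nu> n s)" "s2 \<in> set_pmf (P s1 a b)"
      "x \<in> set_pmf (play \<mu> \<nu> s2)" by (auto simp: set_bind_pmf)
    with Suc P set_play show "x \<in> S \<times> A \<times> B" by blast
  qed
qed (simp add: set_play)

lemma expectation_play:
  fixes h :: "'s \<times> 'a \<times> 'b \<Rightarrow> real"
  assumes "s \<in> S"
  shows "measure_pmf.expectation (play \<mu> \<nu> s) h
    = (\<Sum>a\<in>A. \<Sum>b\<in>B. pmf (\<mu> s) a * h (s, a, b) * pmf (\<nu> s) b)"
proof -
  have "set_pmf (pair_pmf (\<mu> s) (\<nu> s)) \<subseteq> A \<times> B" using assms \<mu> \<nu> by (auto simp: policies_def)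
  then have "measure_pmf.expectation (play \<mu> \<nu> s) h
      = (\<Sum>x\<in>A \<times> B. pmf (pair_pmf (\<mu> s) (\<nu> s)) x * (case x of (a, b) \<Rightarrow> h (s, a, b)))"
    unfolding play_def using fin
    by (subst integral_map_pmf, subst integral_measure_pmf[of "A \<times> B"]) (auto simp: case_prod_unfold)
  also have "\<dots> = (\<Sum>x\<in>A \<times> B. case x of (a, b) \<Rightarrow> pmf (\<mu> s) a * h (s, a, b) * pmf (\<nu> s) b)"
    by (intro sum.cong) (auto simp: pmf_pair)
  finally show ?thesis by (simp add: sum.cartesian_product)
qed

definition soft_reward :: "'s \<times> 'a \<times> 'b \<Rightarrow> real" where
  "soft_reward = (\<lambda>(s, a, b). r s a b - \<tau> * ln (pmf (\<mu> s) a) + \<tau> * ln (pmf (\<nu> s) b))"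

definition expected_reward :: "nat \<Rightarrow> 's \<Rightarrow> real" where
  "expected_reward n s = measure_pmf.expectation (step_law P \<mu> \<nu> n s) soft_reward"

lemma expected_reward_Suc:
  assumes "s \<in> S"
  shows "expected_reward (Suc n) s
    = (\<Sum>a\<in>A. \<Sum>b\<in>B. pmf (\<mu> s) a * (\<Sum>s'\<in>S. pmf (P s a b) s' * expected_reward n s') * pmf (\<nu> s) b)"
proof -
  have f: "finite (set_pmf (step_law P \<mu> \<nu> n s'))" if "s' \<in> S" for s' n
    using set_step_law[OF that, of n] fin by (auto intro: finite_subset)
  let ?F = "\<lambda>(s', a, b). bind_pmf (P s' a b) (step_law P \<mu> \<nu> n)"
  have fF: "finite (set_pmf (?F x))" if mem: "x \<in> S \<times> A \<times> B" for x
  proof -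
    obtain s' a b where x: "x = (s', a, b)" "s' \<in> S" "a \<in> A" "b \<in> B" using mem by (cases x) auto
    have "finite (\<Union>s2\<in>set_pmf (P s' a b). set_pmf (step_law P \<mu> \<nu> n s2))"
      using P[OF x(2-4)] fin f by (intro finite_UN_I) (auto intro: finite_subset)
    then show ?thesis by (simp add: x set_bind_pmf)
  qed
  have "expected_reward (Suc n) s
      = (\<Sum>x\<in>S \<times> A \<times> B. pmf (play \<mu> \<nu> s) x * measure_pmf.expectation (?F x) soft_reward)"
    unfolding expected_reward_def step_law_Suc_first using fin set_play[OF assms] fF
    by (subst pmf_expectation_bind[of "S \<times> A \<times> B"]) simp_all
  also have "\<dots> = measure_pmf.expectation (play \<mu> \<nu> s) (\<lambda>x. measure_pmf.expectation (?F x) soft_reward)"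
    using fin set_play[OF assms] by (subst integral_measure_pmf[of "S \<times> A \<times> B"]) auto
  also have "\<dots> = (\<Sum>a\<in>A. \<Sum>b\<in>B. pmf (\<mu> s) a *
      measure_pmf.expectation (bind_pmf (P s a b) (step_law P \<mu> \<nu> n)) soft_reward * pmf (\<nu> s) b)"
    by (subst expectation_play[OF assms]) simp
  also have "\<dots> = (\<Sum>a\<in>A. \<Sum>b\<in>B. pmf (\<mu> s) a * (\<Sum>s'\<in>S. pmf (P s a b) s' * expected_reward n s') * pmf (\<nu> s) b)"
    using fin P f assms
    by (intro sum.cong refl arg_cong2[of _ _ _ _ "(*)"])
       (subst pmf_expectation_bind[of S], auto simp: expected_reward_def)
  finally show ?thesis .
qed

text \<open>Actions of probability zero are covered by the convention \<open>ln 0 = 0\<close>. The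
  bound depends on the policies, as probabilities may be arbitrarily small, so it justifies
  interchanging limits but cannot bound an infimum over policies.\<close>

lemma soft_reward_bounded: "\<exists>K. \<forall>x\<in>S \<times> A \<times> B. \<bar>soft_reward x\<bar> \<le> K"
  using fin by (intro exI[of _ "Max ((\<lambda>x. \<bar>soft_reward x\<bar>) ` (S \<times> A \<times> B))"]) auto

text \<open>Almost every trajectory stays in the finite carriers, so the geometric series
  \<open>\<gamma> ^ n * K\<close> dominates and sum and integral may be interchanged. Only the
  one-time marginals then matter.\<close>

lemma soft_value_sums:
  assumes s: "s \<in> S"
  shows "(\<lambda>n. \<gamma> ^ n * expected_reward n s) sums soft_value P r \<gamma> \<tau> \<mu> \<nu> s"
proof -
  obtain K where K: "\<And>x. x \<in> S \<times> A \<times> B \<Longrightarrow> \<bar>soft_reward x\<bar> \<le> K" using soft_reward_bounded by blast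
  let ?L = "trajectory_law P \<mu> \<nu> s"
  interpret L: prob_space ?L by (rule prob_space_trajectory_law)
  have f: "finite (set_pmf (step_law P \<mu> \<nu> n s))" for n
    using set_step_law[OF s, of n] fin by (auto intro: finite_subset)
  have int: "integrable ?L (\<lambda>\<omega>. \<gamma> ^ n * soft_reward (\<omega> n))" for n
    by (intro integrable_mult_right) (simp add: integral_trajectory_law(2) integrable_measure_pmf_finite[OF f])
  have ae: "AE \<omega> in ?L. \<bar>soft_reward (\<omega> n)\<bar> \<le> K" for n
    using AE_trajectory_law[of n P \<mu> \<nu> s] by eventually_elim (use K set_step_law[OF s, of n] in blast)
  have sumK: "summable (\<lambda>n. \<gamma> ^ n * K)"
    using \<gamma> by (intro summable_mult2 summable_geometric) auto
  have "(\<lambda>n. \<integral>\<omega>. \<gamma> ^ n * soft_reward (\<omega> n) \<partial>?L) sums (\<integral>\<omega>. (\<Sum>n. \<gamma> ^ n * soft_reward (\<omega> n)) \<partial>?L)"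
  proof (rule sums_integral[OF int])
    have "AE \<omega> in ?L. \<forall>n. \<bar>soft_reward (\<omega> n)\<bar> \<le> K" using ae by (simp add: AE_all_countable)
    then show "AE \<omega> in ?L. summable (\<lambda>n. norm (\<gamma> ^ n * soft_reward (\<omega> n)))"
      by eventually_elim
         (rule summable_comparison_test'[OF sumK, of 0], use \<gamma> in \<open>auto simp: abs_mult intro!: mult_left_mono\<close>)
    show "summable (\<lambda>n. \<integral>\<omega>. norm (\<gamma> ^ n * soft_reward (\<omega> n)) \<partial>?L)"
    proof (rule summable_comparison_test'[OF sumK, of 0])
      fix n
      have "(\<integral>\<omega>. norm (\<gamma> ^ n * soft_reward (\<omega> n)) \<partial>?L) \<le> (\<integral>\<omega>. \<gamma> ^ n * K \<partial>?L)"
        using ae[of n] by (intro integral_mono_AE integrable_norm int)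
          (auto simp: abs_mult \<gamma> elim!: eventually_mono intro!: mult_left_mono)
      also have "\<dots> = \<gamma> ^ n * K" by (simp add: L.prob_space)
      finally show "norm (\<integral>\<omega>. norm (\<gamma> ^ n * soft_reward (\<omega> n)) \<partial>?L) \<le> \<gamma> ^ n * K"
        by (simp add: integral_nonneg_AE)
    qed
  qed
  then show ?thesis
    by (simp add: integral_trajectory_law(1) expected_reward_def soft_value_def soft_reward_def)
qed

text \<open>Splitting off the first term of the series leaves \<gamma> times the expected value at
  the next state. The logarithmic rewards average to entropies because the other player's
  probabilities sum to 1. Later arguments know soft values only through this equation.\<close>

lemma soft_value_bellman:
  assumes s: "s \<in> S"
  shows "soft_value P r \<gamma> \<tau> \<mu> \<nu> s
    = f_reg A B \<tau> (backup P r \<gamma> (soft_value P r \<gamma> \<tau> \<mu> \<nu>) s) (pmf (\<mu> s)) (pmf (\<nu> s))"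
proof -
  let ?V = "soft_value P r \<gamma> \<tau> \<mu> \<nu>"
  let ?T = "\<lambda>v. \<Sum>a\<in>A. \<Sum>b\<in>B. pmf (\<mu> s) a * (\<Sum>s'\<in>S. pmf (P s a b) s' * v s') * pmf (\<nu> s) b"
  have "(\<lambda>n. \<Sum>a\<in>A. \<Sum>b\<in>B. pmf (\<mu> s) a * (\<Sum>s'\<in>S. pmf (P s a b) s' * (\<gamma> ^ n * expected_reward n s')) * pmf (\<nu> s) b)
      sums ?T ?V"
    by (intro sums_sum sums_mult sums_mult2 soft_value_sums)
  then have "(\<lambda>n. \<gamma> ^ n * expected_reward (Suc n) s) sums ?T ?V"
    by (simp add: expected_reward_Suc[OF s] sum_distrib_left mult_ac)
  from sums_mult[OF this, of \<gamma>] have "(\<lambda>n. \<gamma> ^ Suc n * expected_reward (Suc n) s) sums (\<gamma> * ?T ?V)"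
    by (simp add: mult_ac)
  then have "(\<lambda>n. \<gamma> ^ n * expected_reward n s) sums (\<gamma> * ?T ?V + expected_reward 0 s)"
    by (subst (asm) sums_Suc_iff) simp
  then have V: "?V s = \<gamma> * ?T ?V + expected_reward 0 s"
    using soft_value_sums[OF s] sums_unique2 by blast
  have pv: "sum (pmf (\<mu> s)) A = 1" "sum (pmf (\<nu> s)) B = 1"
    using prob_vec_policy \<mu> \<nu> s fin by (auto simp: prob_vec_def)
  have "expected_reward 0 s = bilin A B (r s) (pmf (\<mu> s)) (pmf (\<nu> s))
      - (\<Sum>a\<in>A. \<Sum>b\<in>B. (\<tau> * (pmf (\<mu> s) a * ln (pmf (\<mu> s) a))) * pmf (\<nu> s) b)
      + (\<Sum>a\<in>A. \<Sum>b\<in>B. pmf (\<mu> s) a * (\<tau> * (pmf (\<nu> s) b * ln (pmf (\<nu> s) b))))"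
    by (simp add: expected_reward_def expectation_play[OF s] soft_reward_def bilin_def
          sum.distrib[symmetric] sum_subtractf[symmetric] algebra_simps)
  also have "\<dots> = bilin A B (r s) (pmf (\<mu> s)) (pmf (\<nu> s)) + \<tau> * entropy A (pmf (\<mu> s)) - \<tau> * entropy B (pmf (\<nu> s))"
    by (simp add: pv entropy_def sum_distrib_left[symmetric] sum_distrib_right[symmetric])
  finally have e: "expected_reward 0 s = \<dots>" .
  have "f_reg A B \<tau> (backup P r \<gamma> ?V s) (pmf (\<mu> s)) (pmf (\<nu> s)) = \<gamma> * ?T ?V + expected_reward 0 s"
    unfolding e f_reg_bilin
    using s by (simp add: bilin_def backup_def expectation_P sum_distrib_left sum.distrib algebra_simps)
  with V show ?thesis by simp
qed

end

end

subsection \<open>The minimax soft Bellman operator\<close>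

lemma pmf_of_prob_vec:
  assumes "finite I" "prob_vec I p"
  shows "\<exists>\<pi>. set_pmf \<pi> \<subseteq> I \<and> (\<forall>i\<in>I. pmf \<pi> i = p i)"
proof -
  let ?q = "\<lambda>i. if i \<in> I then p i else 0"
  have nn: "0 \<le> ?q i" for i using assms by (auto simp: prob_vec_def)
  have "(\<integral>\<^sup>+i. ennreal (?q i) \<partial>count_space UNIV) = (\<Sum>i\<in>I. ennreal (?q i))"
    using assms(1) by (intro nn_integral_count_space') auto
  also have "\<dots> = 1" using assms nn by (subst sum_ennreal) (auto simp: prob_vec_def)
  finally have pmf: "pmf (embed_pmf ?q) i = ?q i" for i using nn by (intro pmf_embed_pmf)
  show ?thesis
    by (intro exI[of _ "embed_pmf ?q"]) (auto simp: pmf set_pmf_iff split: if_splits)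
qed

lemma f_reg_cong:
  assumes "\<And>a. a \<in> A \<Longrightarrow> p a = p' a" "\<And>b. b \<in> B \<Longrightarrow> q b = q' b"
  shows "f_reg A B \<tau> M p q = f_reg A B \<tau> M p' q'"
  using assms by (simp add: f_reg_def entropy_def)

lemma bilin_const:
  assumes "prob_vec A p" "prob_vec B q"
  shows "bilin A B (\<lambda>_ _. c) p q = c"
  using assms unfolding bilin_left
  by (simp add: prob_vec_def sum_distrib_left[symmetric] sum_distrib_right[symmetric])

context soft_markov_game
begin

definition minimax_op :: "('s \<Rightarrow> real) \<Rightarrow> 's \<Rightarrow> real" where
  "minimax_op V s = game_value A B \<tau> (backup P r \<gamma> V s)"

lemma minimax_op_mono:
  assumes "s \<in> S" "\<And>s'. s' \<in> S \<Longrightarrow> V s' \<le> V' s' + d"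
  shows "minimax_op V s \<le> minimax_op V' s + \<gamma> * d"
  unfolding minimax_op_def using assms by (intro game_value_mono fin(3-6) \<tau> backup_mono)

lemma minimax_op_contraction:
  assumes "s \<in> S" and le: "\<And>s'. s' \<in> S \<Longrightarrow> \<bar>V s' - V' s'\<bar> \<le> d"
  shows "\<bar>minimax_op V s - minimax_op V' s\<bar> \<le> \<gamma> * d"
proof -
  have "V s' \<le> V' s' + d" "V' s' \<le> V s' + d" if "s' \<in> S" for s' using le[OF that] by auto
  then show ?thesis
    using minimax_op_mono[OF assms(1), of V V' d] minimax_op_mono[OF assms(1), of V' V d] by auto
qed

text \<open>Banach's iteration carried out pointwise: the contraction estimate holds only at states
  in \<open>S\<close>, and values elsewhere are uncontrolled. Successive differences are dominated
  by a geometric series.\<close>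

lemma minimax_op_fixed_point: "\<exists>V. \<forall>s\<in>S. minimax_op V s = V s"
proof -
  define V where "V n = (minimax_op ^^ n) (\<lambda>_. 0)" for n
  define K where "K = (\<Sum>s\<in>S. \<bar>V 1 s\<bar>)"
  have Suc: "V (Suc n) s = minimax_op (V n) s" for n s by (simp add: V_def)
  have le: "\<bar>V (Suc n) s - V n s\<bar> \<le> \<gamma> ^ n * K" if "s \<in> S" for n s
    using that
  proof (induction n arbitrary: s)
    case 0
    then show ?case using member_le_sum[of s S "\<lambda>s. \<bar>V 1 s\<bar>"] fin by (simp add: K_def V_def)
  next
    case (Suc n)
    have "\<bar>minimax_op (V (Suc n)) s - minimax_op (V n) s\<bar> \<le> \<gamma> * (\<gamma> ^ n * K)"
      by (intro minimax_op_contraction Suc)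
    then show ?case by (simp add: \<open>\<And>n s. V (Suc n) s = minimax_op (V n) s\<close> mult.assoc)
  qed
  define V0 where "V0 s = (\<Sum>n. V (Suc n) s - V n s)" for s
  have lim: "(\<lambda>n. V n s) \<longlonglongrightarrow> V0 s" if "s \<in> S" for s
  proof -
    have "summable (\<lambda>n. \<gamma> ^ n * K)" using \<gamma> by (intro summable_mult2 summable_geometric) auto
    then have "summable (\<lambda>n. V (Suc n) s - V n s)"
      by (rule summable_comparison_test'[where N = 0]) (use le[OF that] in auto)
    then have "(\<lambda>n. \<Sum>k<n. V (Suc k) s - V k s) \<longlonglongrightarrow> V0 s"
      unfolding V0_def by (rule summable_LIMSEQ)
    moreover have "(\<Sum>k<n. V (Suc k) s - V k s) = V n s" for n
      using sum_lessThan_telescope[of "\<lambda>n. V n s" n] by (simp add: V_def)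
    ultimately show ?thesis by simp
  qed
  have "minimax_op V0 s = V0 s" if s: "s \<in> S" for s
  proof -
    have "(\<lambda>n. minimax_op (V n) s - minimax_op V0 s) \<longlonglongrightarrow> 0"
    proof (rule Lim_null_comparison)
      show "\<forall>\<^sub>F n in sequentially. norm (minimax_op (V n) s - minimax_op V0 s)
          \<le> \<gamma> * (\<Sum>s'\<in>S. \<bar>V n s' - V0 s'\<bar>)"
        using fin by (intro always_eventually allI)
          (auto intro!: minimax_op_contraction[OF s] member_le_sum)
      have "(\<lambda>n. \<gamma> * (\<Sum>s'\<in>S. \<bar>V n s' - V0 s'\<bar>)) \<longlonglongrightarrow> \<gamma> * (\<Sum>s'\<in>S. \<bar>V0 s' - V0 s'\<bar>)"
        by (intro tendsto_intros lim)
      then show "(\<lambda>n. \<gamma> * (\<Sum>s'\<in>S. \<bar>V n s' - V0 s'\<bar>)) \<longlonglongrightarrow> 0" by simp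
    qed
    then have "(\<lambda>n. minimax_op (V n) s) \<longlonglongrightarrow> minimax_op V0 s" by (rule LIM_zero_cancel)
    moreover have "(\<lambda>n. minimax_op (V n) s) \<longlonglongrightarrow> V0 s"
      using LIMSEQ_Suc[OF lim[OF s]] by (simp add: Suc)
    ultimately show ?thesis by (rule LIMSEQ_unique)
  qed
  then show ?thesis by blast
qed

section \<open>Identification of the optimal soft value\<close>

text \<open>Maximum principle: at a state where \<open>V - W\<close> attains its maximum
  \<open>D\<close>, the two inequalities give \<open>D \<le> \<gamma> * D\<close>, hence
  \<open>D \<le> 0\<close>.\<close>

lemma bellman_comparison:
  assumes pq: "\<And>s. s \<in> S \<Longrightarrow> prob_vec A (p s)" "\<And>s. s \<in> S \<Longrightarrow> prob_vec B (q s)"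
    and V: "\<And>s. s \<in> S \<Longrightarrow> V s \<le> f_reg A B \<tau> (backup P r \<gamma> V s) (p s) (q s)"
    and W: "\<And>s. s \<in> S \<Longrightarrow> f_reg A B \<tau> (backup P r \<gamma> W s) (p s) (q s) \<le> W s"
    and s: "s \<in> S"
  shows "V s \<le> W s"
proof -
  define D where "D = Max ((\<lambda>s. V s - W s) ` S)"
  have D: "V s - W s \<le> D" if "s \<in> S" for s using that fin by (auto simp: D_def)
  have "D \<in> (\<lambda>s. V s - W s) ` S" unfolding D_def using fin by (intro Max_in) auto
  then obtain s0 where s0: "s0 \<in> S" "D = V s0 - W s0" by blast
  have "bilin A B (backup P r \<gamma> V s0) (p s0) (q s0) \<le> bilin A B (backup P r \<gamma> W s0) (p s0) (q s0) + \<gamma> * D"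
  proof (intro bilin_mono pq s0(1) backup_mono)
    fix s' assume "s' \<in> S"
    then show "V s' \<le> W s' + D" using D[of s'] by simp
  qed
  then have "D \<le> \<gamma> * D" using V[OF s0(1)] W[OF s0(1)] s0(2) by (simp add: f_reg_bilin)
  then have "(1 - \<gamma>) * D \<le> 0" by (simp add: algebra_simps)
  then have "D \<le> 0" using \<gamma> by (simp add: mult_le_0_iff)
  then show ?thesis using D[OF s] by simp
qed

text \<open>A bound uniform in the policies, so that the real infimum over \<nu> is meaningful. The
  constant solves \<open>c = \<gamma> * c - \<tau> * ln (card B)\<close>, the worst case of zero
  reward, no entropy for the max player and full entropy for the min player.\<close>

lemma soft_value_lower_bound:
  assumes \<mu>: "\<mu> \<in> policies S A" and \<nu>: "\<nu> \<in> policies S B" and s: "s \<in> S"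
  shows "- (\<tau> * ln (card B)) / (1 - \<gamma>) \<le> soft_value P r \<gamma> \<tau> \<mu> \<nu> s"
proof -
  define c where "c = - (\<tau> * ln (card B)) / (1 - \<gamma>)"
  have c: "c = \<gamma> * c - \<tau> * ln (card B)" using \<gamma> by (simp add: c_def field_simps)
  have "c \<le> f_reg A B \<tau> (backup P r \<gamma> (\<lambda>_. c) s) (pmf (\<mu> s)) (pmf (\<nu> s))" if s: "s \<in> S" for s
  proof -
    have pv: "prob_vec A (pmf (\<mu> s))" "prob_vec B (pmf (\<nu> s))"
      using prob_vec_policy \<mu> \<nu> s fin by auto
    have "bilin A B (\<lambda>_ _. \<gamma> * c) (pmf (\<mu> s)) (pmf (\<nu> s))
        \<le> bilin A B (backup P r \<gamma> (\<lambda>_. c) s) (pmf (\<mu> s)) (pmf (\<nu> s)) + 0"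
      using r s by (intro bilin_mono pv) (simp add: backup_const)
    moreover have "0 \<le> \<tau> * entropy A (pmf (\<mu> s))" "\<tau> * entropy B (pmf (\<nu> s)) \<le> \<tau> * ln (card B)"
      using \<tau> entropy_nonneg[OF pv(1)] entropy_le_ln_card[OF pv(2)] fin by auto
    ultimately show ?thesis using c unfolding f_reg_bilin bilin_const[OF pv] by linarith
  qed
  then have "c \<le> soft_value P r \<gamma> \<tau> \<mu> \<nu> s"
  proof (rule bellman_comparison[where p = "\<lambda>s. pmf (\<mu> s)" and q = "\<lambda>s. pmf (\<nu> s)", OF _ _ _ _ s, rotated 2])
    fix s assume s: "s \<in> S"
    show "prob_vec A (pmf (\<mu> s))" "prob_vec B (pmf (\<nu> s))" using prob_vec_policy \<mu> \<nu> s fin by auto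
    show "f_reg A B \<tau> (backup P r \<gamma> (soft_value P r \<gamma> \<tau> \<mu> \<nu>) s) (pmf (\<mu> s)) (pmf (\<nu> s))
        \<le> soft_value P r \<gamma> \<tau> \<mu> \<nu> s"
      by (rule eq_refl) (rule soft_value_bellman[OF \<mu> \<nu> s, symmetric])
  qed
  then show ?thesis by (simp add: c_def)
qed

text \<open>Playing, in every state, the equilibrium of the game with payoffs
  \<open>backup P r \<gamma> V s\<close> makes \<open>V\<close> a subsolution against every \<nu>
  and a supersolution against every \<mu>. By comparison, \<mu>s guarantees at least
  \<open>V\<close> and \<nu>s concedes at most \<open>V\<close>.\<close>

lemma optimal_soft_value_fixed_point:
  assumes V: "\<And>s. s \<in> S \<Longrightarrow> minimax_op V s = V s" and s: "s \<in> S"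
  shows "optimal_soft_value S A B P r \<gamma> \<tau> s = V s"
proof -
  let ?M = "\<lambda>s. backup P r \<gamma> V s" and ?SV = "soft_value P r \<gamma> \<tau>"
  have "\<exists>pq. qre A B \<tau> (?M s) (fst pq) (snd pq)
      \<and> game_value A B \<tau> (?M s) = f_reg A B \<tau> (?M s) (fst pq) (snd pq)" for s
    using game_value_qre[OF fin(3-6) \<tau>, of "?M s"] by (metis fst_conv snd_conv)
  then obtain pq where pq: "\<And>s. qre A B \<tau> (?M s) (fst (pq s)) (snd (pq s))"
    "\<And>s. game_value A B \<tau> (?M s) = f_reg A B \<tau> (?M s) (fst (pq s)) (snd (pq s))" by metis
  have "\<exists>\<pi>. set_pmf \<pi> \<subseteq> A \<and> (\<forall>a\<in>A. pmf \<pi> a = fst (pq s) a)" for s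
    using pq(1)[of s] fin by (intro pmf_of_prob_vec) (auto simp: qre_def)
  then obtain \<mu>s where \<mu>s: "\<And>s. set_pmf (\<mu>s s) \<subseteq> A" "\<And>s a. a \<in> A \<Longrightarrow> pmf (\<mu>s s) a = fst (pq s) a" by metis
  have "\<exists>\<pi>. set_pmf \<pi> \<subseteq> B \<and> (\<forall>b\<in>B. pmf \<pi> b = snd (pq s) b)" for s
    using pq(1)[of s] fin by (intro pmf_of_prob_vec) (auto simp: qre_def)
  then obtain \<nu>s where \<nu>s: "\<And>s. set_pmf (\<nu>s s) \<subseteq> B" "\<And>s b. b \<in> B \<Longrightarrow> pmf (\<nu>s s) b = snd (pq s) b" by metis
  have pol: "\<mu>s \<in> policies S A" "\<nu>s \<in> policies S B" using \<mu>s \<nu>s by (auto simp: policies_def)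
  have val: "V s = f_reg A B \<tau> (?M s) (fst (pq s)) (snd (pq s))" if "s \<in> S" for s
    using V[OF that] pq(2)[of s] by (simp add: minimax_op_def)
  have lower: "V s \<le> ?SV \<mu>s \<nu> s" if \<nu>: "\<nu> \<in> policies S B" and "s \<in> S" for \<nu> s
  proof (rule bellman_comparison[where p = "\<lambda>s. pmf (\<mu>s s)" and q = "\<lambda>s. pmf (\<nu> s)", OF _ _ _ _ \<open>s \<in> S\<close>])
    fix s assume s: "s \<in> S"
    show pv: "prob_vec A (pmf (\<mu>s s))" "prob_vec B (pmf (\<nu> s))" using prob_vec_policy pol \<nu> s fin by auto
    have "V s \<le> f_reg A B \<tau> (?M s) (fst (pq s)) (pmf (\<nu> s))"
      using qre_saddle(2)[OF pq(1)[of s] \<tau> pv(2)] val[OF s] by simp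
    also have "\<dots> = f_reg A B \<tau> (?M s) (pmf (\<mu>s s)) (pmf (\<nu> s))" by (intro f_reg_cong) (simp_all add: \<mu>s)
    finally show "V s \<le> f_reg A B \<tau> (?M s) (pmf (\<mu>s s)) (pmf (\<nu> s))" .
  qed (rule eq_refl, rule soft_value_bellman[OF pol(1) \<nu>, symmetric])
  have upper: "?SV \<mu> \<nu>s s \<le> V s" if \<mu>: "\<mu> \<in> policies S A" and "s \<in> S" for \<mu> s
  proof (rule bellman_comparison[where p = "\<lambda>s. pmf (\<mu> s)" and q = "\<lambda>s. pmf (\<nu>s s)", OF _ _ _ _ \<open>s \<in> S\<close>])
    fix s assume s: "s \<in> S"
    show pv: "prob_vec A (pmf (\<mu> s))" "prob_vec B (pmf (\<nu>s s))" using prob_vec_policy pol \<mu> s fin by auto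
    have "f_reg A B \<tau> (?M s) (pmf (\<mu> s)) (pmf (\<nu>s s)) = f_reg A B \<tau> (?M s) (pmf (\<mu> s)) (snd (pq s))"
      by (intro f_reg_cong) (simp_all add: \<nu>s)
    also have "\<dots> \<le> V s"
      using qre_saddle(1)[OF pq(1)[of s] \<tau> pv(1)] val[OF s] by simp
    finally show "f_reg A B \<tau> (?M s) (pmf (\<mu> s)) (pmf (\<nu>s s)) \<le> V s" .
  qed (rule eq_refl, rule soft_value_bellman[OF \<mu> pol(2)])
  have inf: "(INF \<nu>\<in>policies S B. ?SV \<mu> \<nu> s) \<le> V s" if "\<mu> \<in> policies S A" for \<mu>
  proof (rule cINF_lower2[OF _ pol(2)])
    show "bdd_below ((\<lambda>\<nu>. ?SV \<mu> \<nu> s) ` policies S B)"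
      using soft_value_lower_bound[OF that _ s] by (rule bdd_belowI2)
  qed (rule upper[OF that s])
  show ?thesis unfolding optimal_soft_value_def
  proof (rule antisym)
    show "(SUP \<mu>\<in>policies S A. INF \<nu>\<in>policies S B. ?SV \<mu> \<nu> s) \<le> V s"
      using pol by (intro cSUP_least inf) auto
    have "V s \<le> (INF \<nu>\<in>policies S B. ?SV \<mu>s \<nu> s)"
      using pol by (intro cINF_greatest lower s) auto
    then show "V s \<le> (SUP \<mu>\<in>policies S A. INF \<nu>\<in>policies S B. ?SV \<mu> \<nu> s)"
      using inf by (intro cSUP_upper2[OF _ pol(1)] bdd_aboveI2) auto
  qed
qed

section \<open>Error propagation in approximate value iteration\<close>

text \<open>This bounds the initial error, since the iteration starts from 0. The assumption
  \<open>card B \<le> card A\<close> makes the regularization shift \<open>?g\<close> nonnegative,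
  so it worsens only the upper estimate, by at most \<open>\<tau> * ln (card A)\<close>.\<close>

lemma minimax_op_fixed_point_bound:
  assumes V: "\<And>s. s \<in> S \<Longrightarrow> minimax_op V s = V s" and s: "s \<in> S" and AB: "card B \<le> card A"
  shows "\<bar>V s\<bar> \<le> (1 + \<tau> * ln (card A)) / (1 - \<gamma>)"
proof -
  define D where "D = Max ((\<lambda>s. \<bar>V s\<bar>) ` S)"
  have D: "\<bar>V s\<bar> \<le> D" if "s \<in> S" for s using that fin by (auto simp: D_def)
  have cB: "1 \<le> card B" using fin by (simp add: Suc_leI card_gt_0_iff)
  have ln: "0 \<le> ln (card B)" "ln (card B) \<le> ln (card A)" using cB AB by auto
  let ?g = "\<tau> * (ln (card A) - ln (card B))"
  have g: "0 \<le> ?g" "?g \<le> \<tau> * ln (card A)" using ln \<tau> by auto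
  have step: "\<bar>V s\<bar> \<le> 1 + \<gamma> * D + \<tau> * ln (card A)" if s: "s \<in> S" for s
  proof -
    have b: "backup P r \<gamma> V s a b \<le> 1 + \<gamma> * D" "- (\<gamma> * D) \<le> backup P r \<gamma> V s a b" if "a \<in> A" "b \<in> B" for a b
    proof -
      have "backup P r \<gamma> V s a b \<le> backup P r \<gamma> (\<lambda>_. 0) s a b + \<gamma> * D"
        using D by (intro backup_mono s that) force
      moreover have "backup P r \<gamma> (\<lambda>_. 0) s a b \<le> backup P r \<gamma> V s a b + \<gamma> * D"
        using D by (intro backup_mono s that) force
      ultimately show "backup P r \<gamma> V s a b \<le> 1 + \<gamma> * D" "- (\<gamma> * D) \<le> backup P r \<gamma> V s a b"
        using r[OF s that] unfolding backup_const by auto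
    qed
    have "game_value A B \<tau> (backup P r \<gamma> V s) \<le> game_value A B \<tau> (\<lambda>_ _. 1 + \<gamma> * D) + 0"
      by (intro game_value_mono fin(3-6) \<tau>) (simp add: b)
    moreover have "game_value A B \<tau> (\<lambda>_ _. - (\<gamma> * D)) \<le> game_value A B \<tau> (backup P r \<gamma> V s) + 0"
      by (intro game_value_mono fin(3-6) \<tau>) (simp add: b)
    ultimately have "V s \<le> 1 + \<gamma> * D + ?g" "- (\<gamma> * D) + ?g \<le> V s"
      using V[OF s] unfolding game_value_const[OF fin(3-6) \<tau>] minimax_op_def by auto
    then show ?thesis using g by (simp only: abs_le_iff) linarith
  qed
  have "D \<in> (\<lambda>s. \<bar>V s\<bar>) ` S" unfolding D_def using fin by (intro Max_in) auto
  then have "D \<le> 1 + \<gamma> * D + \<tau> * ln (card A)" using step by auto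
  then have "D \<le> (1 + \<tau> * ln (card A)) / (1 - \<gamma>)" using \<gamma> by (simp add: field_simps)
  then show ?thesis using D[OF s] by simp
qed

text \<open>Regularization shifts the game values by the same constant in every state, so up to the
  inner error it does not enlarge the oscillation of the iterates.\<close>

lemma Q_iterate_oscillation:
  assumes \<delta>: "0 \<le> \<delta>" "1 + 2 * \<delta> \<le> (1 - \<gamma>) * W"
    and inner: "\<And>lo Q s. s \<in> S \<Longrightarrow> (\<And>a b. a \<in> A \<Longrightarrow> b \<in> B \<Longrightarrow> lo \<le> Q s a b \<and> Q s a b \<le> lo + W) \<Longrightarrow>
      \<bar>approx_value alg A B \<eta> \<tau> N Q s - game_value A B \<tau> (Q s)\<bar> \<le> \<delta>"
  shows "\<exists>lo. \<forall>s\<in>S. \<forall>a\<in>A. \<forall>b\<in>B. lo \<le> Q_iterate alg A B P r \<gamma> \<eta> \<tau> N t s a b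
    \<and> Q_iterate alg A B P r \<gamma> \<eta> \<tau> N t s a b \<le> lo + W"
proof (induction t)
  case 0
  have "0 < (1 - \<gamma>) * W" using \<delta> by linarith
  then have "0 \<le> W" using \<gamma> by (simp add: zero_less_mult_iff)
  then show ?case by (auto intro!: exI[of _ 0])
next
  case (Suc t)
  let ?Q = "Q_iterate alg A B P r \<gamma> \<eta> \<tau> N t"
  let ?V = "approx_value alg A B \<eta> \<tau> N ?Q"
  obtain lo where lo: "\<And>s a b. s \<in> S \<Longrightarrow> a \<in> A \<Longrightarrow> b \<in> B \<Longrightarrow> lo \<le> ?Q s a b \<and> ?Q s a b \<le> lo + W"
    using Suc by blast
  let ?g = "\<tau> * (ln (card A) - ln (card B))"
  have V: "lo + ?g - \<delta> \<le> ?V s" "?V s \<le> lo + W + ?g + \<delta>" if s: "s \<in> S" for s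
  proof -
    have "game_value A B \<tau> (?Q s) \<le> game_value A B \<tau> (\<lambda>_ _. lo + W) + 0"
      by (intro game_value_mono fin(3-6) \<tau>) (simp add: lo s)
    moreover have "game_value A B \<tau> (\<lambda>_ _. lo) \<le> game_value A B \<tau> (?Q s) + 0"
      by (intro game_value_mono fin(3-6) \<tau>) (simp add: lo s)
    moreover have "\<bar>?V s - game_value A B \<tau> (?Q s)\<bar> \<le> \<delta>" by (rule inner[OF s, of lo]) (simp add: lo s)
    ultimately show "lo + ?g - \<delta> \<le> ?V s" "?V s \<le> lo + W + ?g + \<delta>"
      unfolding game_value_const[OF fin(3-6) \<tau>] by auto
  qed
  show ?case
  \<comment> \<open>One lower end must serve all states, because transitions mix their values in the
    next backup. The witness is the backup of the least possible value with reward 0.\<close>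
  proof (intro exI[of _ "\<gamma> * (lo + ?g - \<delta>)"] ballI)
    fix s a b assume sab: "s \<in> S" "a \<in> A" "b \<in> B"
    have "backup P r \<gamma> (\<lambda>_. lo + ?g - \<delta>) s a b \<le> backup P r \<gamma> ?V s a b + \<gamma> * 0"
      using V by (intro backup_mono sab) simp
    moreover have "backup P r \<gamma> ?V s a b \<le> backup P r \<gamma> (\<lambda>_. lo + W + ?g + \<delta>) s a b + \<gamma> * 0"
      using V by (intro backup_mono sab) simp
    \<comment> \<open>The shift \<open>?g\<close> occurs on both sides and cancels: the new
      oscillation is at most \<open>1 + \<gamma> * (W + 2 * \<delta>)\<close>, and the hypothesis on
      \<open>W\<close> makes this at most \<open>W\<close>.\<close>
    moreover have "1 + \<gamma> * (lo + W + ?g + \<delta>) \<le> \<gamma> * (lo + ?g - \<delta>) + W"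
    proof -
      have "\<gamma> * (2 * \<delta>) \<le> 1 * (2 * \<delta>)" using \<gamma> \<delta> by (intro mult_right_mono) auto
      then show ?thesis using \<delta>(2) by (simp add: algebra_simps)
    qed
    ultimately show "\<gamma> * (lo + ?g - \<delta>) \<le> Q_iterate alg A B P r \<gamma> \<eta> \<tau> N (Suc t) s a b \<and>
       Q_iterate alg A B P r \<gamma> \<eta> \<tau> N (Suc t) s a b \<le> \<gamma> * (lo + ?g - \<delta>) + W"
      using r[OF sab] unfolding backup_const by simp
  qed
qed

text \<open>One round adds an inner error \<delta> and multiplies the total by \<gamma>. The
  oscillation bound is what keeps every iterate within the range where \<open>inner\<close>
  applies.\<close>

lemma Q_iterate_error:
  assumes \<delta>: "0 \<le> \<delta>" "1 + 2 * \<delta> \<le> (1 - \<gamma>) * W"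
    and inner: "\<And>lo Q s. s \<in> S \<Longrightarrow> (\<And>a b. a \<in> A \<Longrightarrow> b \<in> B \<Longrightarrow> lo \<le> Q s a b \<and> Q s a b \<le> lo + W) \<Longrightarrow>
      \<bar>approx_value alg A B \<eta> \<tau> N Q s - game_value A B \<tau> (Q s)\<bar> \<le> \<delta>"
    and AB: "card B \<le> card A" and sab: "s \<in> S" "a \<in> A" "b \<in> B"
  shows "\<bar>Q_iterate alg A B P r \<gamma> \<eta> \<tau> N t s a b - optimal_soft_Q S A B P r \<gamma> \<tau> s a b\<bar>
    \<le> \<gamma> ^ t * ((1 + \<tau> * ln (card A)) / (1 - \<gamma>)) + \<delta> / (1 - \<gamma>)"
proof -
  obtain V where V: "\<And>s. s \<in> S \<Longrightarrow> minimax_op V s = V s" using minimax_op_fixed_point by blast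
  define D where "D = (1 + \<tau> * ln (card A)) / (1 - \<gamma>)"
  let ?Q = "Q_iterate alg A B P r \<gamma> \<eta> \<tau> N"
  have opt: "optimal_soft_Q S A B P r \<gamma> \<tau> s a b = backup P r \<gamma> V s a b" if "s \<in> S" "a \<in> A" "b \<in> B" for s a b
    using optimal_soft_value_fixed_point[OF V] that
    by (simp add: optimal_soft_Q_def backup_def expectation_P)
  have lnA: "0 \<le> ln (card A)" using fin by (simp add: Suc_leI card_gt_0_iff)
  have D: "0 \<le> D" "1 + \<gamma> * D \<le> D"
  proof -
    have "(1 - \<gamma>) * D = 1 + \<tau> * ln (card A)" using \<gamma> by (simp add: D_def)
    moreover have "0 \<le> \<tau> * ln (card A)" using lnA \<tau> by simp
    ultimately show "1 + \<gamma> * D \<le> D" by (simp add: algebra_simps)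
    show "0 \<le> D" unfolding D_def using \<gamma> \<tau> lnA by simp
  qed
  have "\<bar>?Q t s a b - backup P r \<gamma> V s a b\<bar> \<le> \<gamma> ^ t * D + \<delta> / (1 - \<gamma>)"
    if "s \<in> S" "a \<in> A" "b \<in> B" for s a b
    using that
  proof (induction t arbitrary: s a b)
    case 0
    have "backup P r \<gamma> V s a b \<le> backup P r \<gamma> (\<lambda>_. 0) s a b + \<gamma> * D"
      using minimax_op_fixed_point_bound[OF V _ AB] by (intro backup_mono 0) (force simp: D_def)
    moreover have "backup P r \<gamma> (\<lambda>_. 0) s a b \<le> backup P r \<gamma> V s a b + \<gamma> * D"
      using minimax_op_fixed_point_bound[OF V _ AB] by (intro backup_mono 0) (force simp: D_def)
    moreover have "0 \<le> \<delta> / (1 - \<gamma>)" using \<delta> \<gamma> by simp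
    ultimately show ?case using r[OF 0] D unfolding backup_const by (simp add: abs_le_iff)
  next
    case (Suc t)
    let ?V = "approx_value alg A B \<eta> \<tau> N (?Q t)"
    let ?e = "\<gamma> ^ t * D + \<delta> / (1 - \<gamma>)"
    have "\<exists>lo. \<forall>s\<in>S. \<forall>a\<in>A. \<forall>b\<in>B. lo \<le> ?Q t s a b \<and> ?Q t s a b \<le> lo + W"
      by (rule Q_iterate_oscillation[OF \<delta>]) (rule inner)
    then obtain lo where lo: "\<And>s a b. s \<in> S \<Longrightarrow> a \<in> A \<Longrightarrow> b \<in> B \<Longrightarrow> lo \<le> ?Q t s a b \<and> ?Q t s a b \<le> lo + W"
      by blast
    have V': "\<bar>?V s - V s\<bar> \<le> \<delta> + ?e" if s: "s \<in> S" for s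
    proof -
      have "game_value A B \<tau> (?Q t s) \<le> game_value A B \<tau> (backup P r \<gamma> V s) + ?e"
        using Suc.IH[OF s] by (intro game_value_mono fin(3-6) \<tau>) (force simp: abs_le_iff)
      moreover have "game_value A B \<tau> (backup P r \<gamma> V s) \<le> game_value A B \<tau> (?Q t s) + ?e"
        using Suc.IH[OF s] by (intro game_value_mono fin(3-6) \<tau>) (force simp: abs_le_iff)
      moreover have "\<bar>?V s - game_value A B \<tau> (?Q t s)\<bar> \<le> \<delta>" by (rule inner[OF s, of lo]) (simp add: lo s)
      ultimately show ?thesis using V[OF s] unfolding minimax_op_def by linarith
    qed
    have "backup P r \<gamma> ?V s a b \<le> backup P r \<gamma> V s a b + \<gamma> * (\<delta> + ?e)"
      using V' by (intro backup_mono Suc.prems) (force simp: abs_le_iff)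
    moreover have "backup P r \<gamma> V s a b \<le> backup P r \<gamma> ?V s a b + \<gamma> * (\<delta> + ?e)"
      using V' by (intro backup_mono Suc.prems) (force simp: abs_le_iff)
    moreover have "\<gamma> * (\<delta> + ?e) \<le> \<gamma> ^ Suc t * D + \<delta> / (1 - \<gamma>)"
    proof -
      \<comment> \<open>This says \<open>2 * \<gamma> - \<gamma>\<^sup>2 \<le> 1\<close>, which is
        the invariance of the accumulated error \<open>\<delta> / (1 - \<gamma>)\<close> under one
        round.\<close>
      have "0 \<le> (1 - \<gamma>)\<^sup>2" by simp
      then have "\<gamma> * (1 - \<gamma>) + \<gamma> \<le> 1" by (simp add: power2_eq_square algebra_simps)
      then have "(\<gamma> * (1 - \<gamma>) + \<gamma>) * \<delta> / (1 - \<gamma>) \<le> 1 * \<delta> / (1 - \<gamma>)"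
        using \<gamma> \<delta> by (intro divide_right_mono mult_right_mono) auto
      moreover have "(\<gamma> * (1 - \<gamma>) + \<gamma>) * \<delta> / (1 - \<gamma>) = \<gamma> * \<delta> + \<gamma> * (\<delta> / (1 - \<gamma>))"
        using \<gamma> by (simp add: field_simps)
      ultimately show ?thesis by (simp add: algebra_simps)
    qed
    ultimately show ?case by (simp add: abs_le_iff)
  qed
  from this[OF sab] show ?thesis unfolding opt[OF sab] D_def .
qed

end

section \<open>Choice of the iteration counts\<close>

lemma power_le_exp:
  fixes x y :: real
  assumes "0 \<le> x" "x \<le> 1" "y \<le> x * real n"
  shows "(1 - x) ^ n \<le> exp (- y)"
proof -
  have "(1 - x) ^ n \<le> exp (- x) ^ n"
    using assms exp_ge_add_one_self[of "- x"] by (intro power_mono) auto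
  also have "\<dots> = exp (- (x * real n))" by (simp add: exp_of_nat_mult[symmetric] mult.commute)
  also have "\<dots> \<le> exp (- y)" using assms by simp
  finally show ?thesis .
qed

text \<open>The logarithm in the bound may vanish for large \<epsilon>; capping \<epsilon> at
  \<open>\<epsilon>0\<close> expresses that the O-bound concerns small accuracies. The counts are
  fixed before the state space, transitions and rewards, so they work for all games with the same
  action sets and discount.\<close>

theorem theorem3:
  shows "\<exists>(C :: real) (\<epsilon>0 :: real). C > 0 \<and> \<epsilon>0 > 0 \<and> (
    \<forall>alg (A :: 'a set) (B :: 'b set) (\<gamma> :: real) (\<tau> :: real) (\<epsilon> :: real).
      finite A \<and> finite B \<and> B \<noteq> {} \<and> card A \<ge> card B \<and> card A \<ge> 2 \<and>
      0 \<le> \<gamma> \<and> \<gamma> < 1 \<and> 0 < \<tau> \<and> \<tau> \<le> 1 \<and> 0 < \<epsilon> \<longrightarrow>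
      (\<exists>Tmain Tsub. 0 < Tmain \<and> 0 < Tsub \<and>
         real (Tmain * Tsub) \<le>
           C * ((ln (real (card A)) + 1 / \<tau>) / (1 - \<gamma>)\<^sup>2
                * (ln (ln (real (card A)) / ((1 - \<gamma>) * min \<epsilon> \<epsilon>0)))\<^sup>2) \<and>
         (\<forall>(S :: 's set) P r. markov_game S A B P r \<gamma> \<longrightarrow>
            (let \<eta> = (1 - \<gamma>) / (2 * (1 + \<tau> * (ln (real (card A)) + 1 - \<gamma>)))
             in max_norm S A B
                  (\<lambda>s a b. Q_iterate alg A B P r \<gamma> \<eta> \<tau> Tsub Tmain s a b
                           - optimal_soft_Q S A B P r \<gamma> \<tau> s a b) \<le> \<epsilon>))))"
\<comment> \<open>30 is the product of 3 for the outer and 10 for the inner count. The cap 1/100 is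
  small enough for the inner error, which needs \<open>48 * e \<le> 1 / 2\<close>.\<close>
proof (rule exI[of _ 30], rule exI[of _ "1 / 100"], intro conjI allI impI)
  fix alg and A :: "'a set" and B :: "'b set" and \<gamma> \<tau> \<epsilon> :: real
  assume "finite A \<and> finite B \<and> B \<noteq> {} \<and> card A \<ge> card B \<and> card A \<ge> 2 \<and>
      0 \<le> \<gamma> \<and> \<gamma> < 1 \<and> 0 < \<tau> \<and> \<tau> \<le> 1 \<and> 0 < \<epsilon>"
  then have fin: "finite A" "A \<noteq> {}" "finite B" "B \<noteq> {}" and card: "card B \<le> card A" "2 \<le> card A"
    and \<gamma>: "0 \<le> \<gamma>" "\<gamma> < 1" and \<tau>: "0 < \<tau>" "\<tau> \<le> 1" and \<epsilon>: "0 < \<epsilon>" by auto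
  define u where "u = 1 - \<gamma>"
  define L where "L = ln (real (card A))"
  define e where "e = min \<epsilon> (1 / 100)"
  define X where "X = L / (u * e)"
  define l where "l = ln X"
  define \<eta> where "\<eta> = u / (2 * (1 + \<tau> * (L + u)))"
  \<comment> \<open>The inner error \<open>u * e / 2\<close> requires only
    \<open>1 + u * e \<le> u * W\<close>, so 9/8 has room to spare; with
    \<open>\<eta> \<le> u / 2\<close> it yields the bound 9/16.\<close>
  define W where "W = 9 / 8 / u"
  have u: "0 < u" "u \<le> 1" using \<gamma> by (auto simp: u_def)
  have e: "0 < e" "e \<le> 1 / 100" "e \<le> \<epsilon>" using \<epsilon> by (auto simp: e_def)
  have L: "2 / 3 \<le> L"
  proof -
    have "ln 2 \<le> L" unfolding L_def using card by simp
    then show ?thesis using ln2_ge_two_thirds by linarith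
  qed
  have ue: "0 < u * e" "u * e \<le> 1 / 100"
    using u e mult_mono[of u 1 e "1 / 100"] by auto
  have X: "3 \<le> X" using L ue by (simp add: X_def le_divide_eq)
  \<comment> \<open>A logarithm of at least 1 lets the roundings in \<open>k\<close> and
    \<open>T\<close> and the extra step in \<open>Suc k\<close> be absorbed into constants.\<close>
  have l: "1 \<le> l" using exp_le X by (simp add: l_def ln_ge_iff)
  have exp_l: "exp (- (2 * l)) = 1 / X\<^sup>2"
    using X by (simp add: l_def exp_minus exp_double power2_eq_square inverse_eq_divide)
  have invX: "1 / X\<^sup>2 = (u * e)\<^sup>2 / L\<^sup>2" using X L by (simp add: X_def power_divide)
  have den: "0 < 1 + \<tau> * (L + u)" using \<tau> L u by (simp add: add_pos_pos)
  have \<eta>: "0 < \<eta>" using u den by (simp add: \<eta>_def)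
  have \<eta>\<tau>: "\<eta> * \<tau> \<le> 1 / 5"
  proof -
    have "\<tau> * u \<le> \<tau> * 1" "\<tau> * (2 / 3) \<le> \<tau> * L" using \<tau> u L by (auto intro: mult_left_mono)
    then have "3 * (\<tau> * u) \<le> 2 + 2 * (\<tau> * L)" using \<tau> by linarith
    then have "5 * (u * \<tau>) \<le> 2 * (1 + \<tau> * (L + u))" by (simp add: algebra_simps)
    then show ?thesis using den by (simp add: \<eta>_def field_simps)
  qed
  have \<eta>W: "\<eta> * W \<le> 9 / 16"
  proof -
    have "0 \<le> \<tau> * (L + u)" using \<tau> L u by simp
    then show ?thesis using u den by (simp add: \<eta>_def W_def field_simps)
  qed
  have inv_\<eta>: "1 / \<eta> \<le> 8 * L / u"
  proof -
    have "\<tau> * (L + u) \<le> 1 * (L + 1)" using \<tau> L u by (intro mult_mono) auto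
    then have "2 * (1 + \<tau> * (L + u)) \<le> 8 * L" using L by simp
    then show ?thesis unfolding \<eta>_def using u by (simp add: divide_right_mono)
  qed
  \<comment> \<open>Both counts make their contraction factor at most
    \<open>exp (- (2 * l)) = 1 / X\<^sup>2\<close>. The square is needed because the inner error has
    a prefactor of order \<open>L\<^sup>2 / u\<close>: one factor comes from
    \<open>1 / \<eta>\<close>, the other from the initial potential.\<close>
  define k where "k = nat \<lceil>2 * l / (\<eta> * \<tau>)\<rceil>"
  define T where "T = nat \<lceil>2 * l / u\<rceil>"
  have \<eta>\<tau>0: "0 < \<eta> * \<tau>" using \<eta> \<tau> by simp
  have k: "2 * l / (\<eta> * \<tau>) \<le> real k" "real k \<le> 2 * l / (\<eta> * \<tau>) + 1"
    using l \<eta>\<tau>0 unfolding k_def by (linarith | simp add: of_nat_nat)+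
  have T: "2 * l / u \<le> real T" "real T \<le> 2 * l / u + 1"
    using l u unfolding T_def by (linarith | simp add: of_nat_nat)+
  have "0 < 2 * l / u" using l u by simp
  then have T0: "0 < T" using T by (metis of_nat_0_less_iff less_le_trans)
  define \<delta> where "\<delta> = u * e / 2"
  have \<delta>: "0 \<le> \<delta>" "1 + 2 * \<delta> \<le> (1 - \<gamma>) * W"
    using ue u unfolding \<delta>_def W_def u_def[symmetric] by auto
  have lnB: "ln (real (card B)) \<le> L" "0 \<le> ln (real (card B))"
    unfolding L_def using card fin by (simp_all add: card_gt_0_iff Suc_leI)
  have inner: "\<bar>approx_value alg A B \<eta> \<tau> (Suc k) Q s - game_value A B \<tau> (Q s)\<bar> \<le> \<delta>"
    if "\<And>a b. a \<in> A \<Longrightarrow> b \<in> B \<Longrightarrow> lo \<le> Q s a b \<and> Q s a b \<le> lo + W" for lo and Q :: "'s \<Rightarrow> 'a \<Rightarrow> 'b \<Rightarrow> real" and s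
  proof -
    have pw: "(1 - \<eta> * \<tau>) ^ k \<le> 1 / X\<^sup>2"
      unfolding exp_l[symmetric] using \<eta>\<tau> \<eta>\<tau>0 k(1) by (intro power_le_exp) (auto simp: field_simps)
    have "\<bar>approx_value alg A B \<eta> \<tau> (Suc k) Q s - game_value A B \<tau> (Q s)\<bar>
        \<le> 3 / \<eta> * ((1 - \<eta> * \<tau>) ^ k * (ln (card A) + ln (card B)))"
      by (rule approx_value_error[OF fin \<eta> \<tau>(1) \<eta>\<tau> \<eta>W]) (rule that)
    also have "\<dots> \<le> 3 / \<eta> * (1 / X\<^sup>2 * (2 * L))"
      using pw lnB L \<eta> \<eta>\<tau> by (intro mult_left_mono mult_mono) (auto simp: L_def)
    also have "\<dots> = (1 / \<eta>) * (6 * L / X\<^sup>2)" by simp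
    also have "\<dots> \<le> (8 * L / u) * (6 * L / X\<^sup>2)" using L by (intro mult_right_mono inv_\<eta>) auto
    also have "\<dots> = 48 * L\<^sup>2 / u * (1 / X\<^sup>2)" by (simp add: power2_eq_square)
    also have "\<dots> = u * e * (48 * e)" unfolding invX using L u by (simp add: power2_eq_square)
    also have "\<dots> \<le> u * e * (1 / 2)" using ue e by (intro mult_left_mono) auto
    finally show ?thesis by (simp add: \<delta>_def)
  qed
  have outer: "\<gamma> ^ T * ((1 + \<tau> * L) / u) \<le> e / 2"
  proof -
    have "\<gamma> ^ T \<le> 1 / X\<^sup>2"
      unfolding exp_l[symmetric] using power_le_exp[of u "2 * l" T] u T(1) by (simp add: u_def field_simps)
    moreover have "\<tau> * L \<le> 1 * L" using \<tau> L by (intro mult_right_mono) auto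
    then have "1 + \<tau> * L \<le> 5 / 2 * L" using L by linarith
    ultimately have "\<gamma> ^ T * ((1 + \<tau> * L) / u) \<le> 1 / X\<^sup>2 * (5 / 2 * L / u)"
      using u \<tau> L \<gamma> by (intro mult_mono divide_right_mono) auto
    also have "\<dots> = e * (u * e) * (5 / 2 / L)" unfolding invX using L u by (simp add: power2_eq_square)
    also have "\<dots> \<le> e * (1 / 100) * (15 / 4)"
      using ue e L by (intro mult_mono) (auto simp: field_simps)
    also have "\<dots> \<le> e / 2" using e by simp
    finally show ?thesis .
  qed
  have count: "real (T * Suc k) \<le> 30 * ((L + 1 / \<tau>) / u\<^sup>2 * l\<^sup>2)"
  proof -
    have "1 \<le> 1 / u" "1 \<le> 1 / \<tau>" using u \<tau> by auto
    have "1 * 1 \<le> l * (1 / u)" using l u by (intro mult_mono) auto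
    then have lu: "1 \<le> l / u" by simp
    have A1: "real T \<le> 3 * (l / u)" using T(2) lu by simp
    \<comment> \<open>Origin of \<open>L + 1 / \<tau>\<close> and of one factor \<open>1 / u\<close>
      in the bound; the other \<open>1 / u\<close> comes from \<open>T\<close>.\<close>
    have "1 / (\<eta> * \<tau>) = 2 * (1 / \<tau> + (L + u)) / u"
      unfolding \<eta>_def using u \<tau> den by (simp add: field_simps)
    also have "\<dots> \<le> 4 * (L + 1 / \<tau>) / u"
      using u L \<open>1 \<le> 1 / \<tau>\<close> by (intro divide_right_mono) auto
    finally have "2 * l * (1 / (\<eta> * \<tau>)) \<le> 2 * l * (4 * (L + 1 / \<tau>) / u)"
      using l by (intro mult_left_mono) auto
    then have 1: "2 * l / (\<eta> * \<tau>) \<le> 8 * ((L + 1 / \<tau>) * (l / u))" by (simp add: algebra_simps add_divide_distrib)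
    have 2: "1 * 1 \<le> (L + 1 / \<tau>) * (l / u)" using lu L \<open>1 \<le> 1 / \<tau>\<close> by (intro mult_mono) auto
    have A2: "real (Suc k) \<le> 10 * ((L + 1 / \<tau>) * (l / u))" using k(2) 1 2 by simp
    have "real T * real (Suc k) \<le> 3 * (l / u) * (10 * ((L + 1 / \<tau>) * (l / u)))"
      using A1 A2 lu by (intro mult_mono) auto
    also have "\<dots> = 30 * ((L + 1 / \<tau>) / u\<^sup>2 * l\<^sup>2)" by (simp add: power2_eq_square)
    finally show ?thesis by (simp only: of_nat_mult)
  qed
  have \<eta>_eq: "(1 - \<gamma>) / (2 * (1 + \<tau> * (ln (real (card A)) + 1 - \<gamma>))) = \<eta>"
    by (simp add: \<eta>_def u_def L_def algebra_simps)
  show "\<exists>Tmain Tsub. 0 < Tmain \<and> 0 < Tsub \<and>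
         real (Tmain * Tsub) \<le>
           30 * ((ln (real (card A)) + 1 / \<tau>) / (1 - \<gamma>)\<^sup>2
                * (ln (ln (real (card A)) / ((1 - \<gamma>) * min \<epsilon> (1 / 100))))\<^sup>2) \<and>
         (\<forall>(S :: 's set) P r. markov_game S A B P r \<gamma> \<longrightarrow>
            (let \<eta> = (1 - \<gamma>) / (2 * (1 + \<tau> * (ln (real (card A)) + 1 - \<gamma>)))
             in max_norm S A B
                  (\<lambda>s a b. Q_iterate alg A B P r \<gamma> \<eta> \<tau> Tsub Tmain s a b
                           - optimal_soft_Q S A B P r \<gamma> \<tau> s a b) \<le> \<epsilon>))"
    unfolding \<eta>_eq Let_def
  proof (rule exI[of _ T], rule exI[of _ "Suc k"], intro conjI allI impI)
    show "real (T * Suc k) \<le> 30 * ((ln (real (card A)) + 1 / \<tau>) / (1 - \<gamma>)\<^sup>2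
                * (ln (ln (real (card A)) / ((1 - \<gamma>) * min \<epsilon> (1 / 100))))\<^sup>2)"
      using count unfolding l_def X_def L_def u_def e_def .
    fix S :: "'s set" and P r
    assume game: "markov_game S A B P r \<gamma>"
    interpret soft_markov_game S A B P r \<gamma> \<tau> using game \<tau> by unfold_locales
    have "\<bar>Q_iterate alg A B P r \<gamma> \<eta> \<tau> (Suc k) T s a b - optimal_soft_Q S A B P r \<gamma> \<tau> s a b\<bar> \<le> \<epsilon>"
      if "s \<in> S" "a \<in> A" "b \<in> B" for s a b
    proof -
      have "\<bar>Q_iterate alg A B P r \<gamma> \<eta> \<tau> (Suc k) T s a b - optimal_soft_Q S A B P r \<gamma> \<tau> s a b\<bar>
          \<le> \<gamma> ^ T * ((1 + \<tau> * L) / u) + \<delta> / u"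
        unfolding L_def u_def by (rule Q_iterate_error[OF \<delta> _ card(1) that]) (rule inner)
      also have "\<dots> \<le> e / 2 + e / 2" using u by (intro add_mono outer) (simp add: \<delta>_def)
      finally show ?thesis using e by simp
    qed
    then show "max_norm S A B (\<lambda>s a b. Q_iterate alg A B P r \<gamma> \<eta> \<tau> (Suc k) T s a b
        - optimal_soft_Q S A B P r \<gamma> \<tau> s a b) \<le> \<epsilon>"
      using game unfolding max_norm_def markov_game_def by (subst Max_le_iff) auto
  qed (use T0 in auto)
qed simp_all

end
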